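(* Let $\mathsf{Q}=(\mathsf{Q},\&,k)$ be a non-trivial, commutative and unital quantale. Assuming the axiom of choice, the category $\mathsf{Q}\text{-}\mathbf{Map}^{\partial}$ of sets and partial $\mathsf{Q}$-maps is equivalent to the coslice category $\{\star\}/\mathsf{Q}\text{-}\mathbf{Map}$ and, therefore, is monadic over $\mathsf{Q}\text{-}\mathbf{Map}$.
   Context: A non-trivial, commutative and unital quantale $\mathsf{Q}=(\mathsf{Q},\&,k)$ is a complete lattice $\mathsf{Q}$ (top $\top$, bottom $\bot$) with a commutative monoid structure $(\mathsf{Q},\&,k)$ such that $\bot<k$ and $p\mathbin{\&}\bigvee_{i\in I} q_i=\bigvee_{i\in I} p\mathbin{\&}q_i$ for all families. For sets $X,Y$, a $\mathsf{Q}$-relation $\phi\colon X\nrightarrow Y$ is a function $\phi\colon X\times Y\to\mathsf{Q}$; $\mathsf{Q}$-relations are ordered pointwise. The composite of $\phi\colon X\nrightarrow Y$ and $\psi\colon Y\nrightarrow Z$ is $(\psi\circ\phi)(x,z)=\bigvee_{y\in Y}\psi(y,z)\mathbin{\&}\phi(x,y)$; the identity is $\mathrm{id}_X(x,x)=k$ and $\mathrm{id}_X(x,y)=\bot$ for $x\ne y$. A $\mathsf{Q}$-map from $X$ to $Y$ is a $\mathsf{Q}$-relation $\zeta\colon X\nrightarrow Y$ having a right adjoint, i.e. there is $\eta\colon Y\nrightarrow X$ with $\mathrm{id}_X\le\eta\circ\zeta$ and $\zeta\circ\eta\le\mathrm{id}_Y$. $\mathsf{Q}\text{-}\mathbf{Map}$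 is the category of sets and $\mathsf{Q}$-maps. $\{\star\}$ is the singleton set. The coslice category $\{\star\}/\mathsf{Q}\text{-}\mathbf{Map}$ has as objects pairs $(X,\mu)$ with $X$ a set and $\mu\colon\{\star\}\nrightarrow X$ a $\mathsf{Q}$-map; a morphism $(X,\mu)\to(Y,\lambda)$ is a $\mathsf{Q}$-map $\zeta\colon X\nrightarrow Y$ with $\zeta\circ\mu=\lambda$. Write $X_+=X\amalg\{\star\}$ for the disjoint union. A partial $\mathsf{Q}$-map from $X$ to $Y$ is a $\mathsf{Q}$-map $\zeta\colon X\nrightarrow Y_+$. $\mathsf{Q}\text{-}\mathbf{Map}^{\partial}$ is the Kleisli category of the maybe monad $X\mapsto X_+$ on $\mathsf{Q}\text{-}\mathbf{Map}$, i.e. the monad induced by the forgetful functor $\{\star\}/\mathsf{Q}\text{-}\mathbf{Map}\to\mathsf{Q}\text{-}\mathbf{Map}$, $(X,\mu)\mapsto X$, and its left adjoint sending $X$ to the graph of the inclusion $\{\star\}\hookrightarrow X_+$. Explicitly: objects are sets, morphisms from $X$ to $Y$ are partial $\mathsf{Q}$-maps, and the composite of $\zeta\colon X\nrightarrow Y_+$ and $\eta\colon Y\nrightarrow Z_+$ is given by $(\eta\diamond\zeta)(x,z)=\bigvee_{y\in Y}\eta(y,z)\mathbin{\&}\zeta(x,y)$ for $z\in Z$ and $(\eta\diamond\zeta)(x,\star)=\big(\bigvee_{y\in Y}\eta(y,\star)\mathbin{\&}\zeta(x,y)\big)\vee\zeta(x,\star)$; the identity on $X$ is the graph of the inclusion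 $X\hookrightarrow X_+$ (value $k$ at $(x,x)$, $\bot$ elsewhere). Monadicity over $\mathsf{Q}\text{-}\mathbf{Map}$ refers to the right adjoint functor $\mathsf{U}_{\mathsf{T}}\colon\mathsf{Q}\text{-}\mathbf{Map}^{\partial}\to\mathsf{Q}\text{-}\mathbf{Map}$ sending $X$ to $X_+$ and $\zeta\colon X\nrightarrow Y_+$ to the $\mathsf{Q}$-map $X_+\nrightarrow Y_+$ that equals $\zeta$ on $X\times Y_+$, has value $k$ at $(\star,\star)$ and $\bot$ at $(\star,y)$ for $y\in Y$; monadic means that the comparison functor to the Eilenberg–Moore category of the induced monad on $\mathsf{Q}\text{-}\mathbf{Map}$ is an equivalence of categories. *)

theory Defs
  imports Main "HOL-Library.FuncSet"
begin

(* Hom-sets are indexed by their end points and need not be disjoint, so composition and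
   the morphism part of a functor also take the objects as arguments:
   Compose C X Y Z g f  is  g o f : X -> Z  for  f : X -> Y  and  g : Y -> Z. *)
record ('o, 'm) cat =
  Obj :: "'o set"
  Hom :: "'o \<Rightarrow> 'o \<Rightarrow> 'm set"
  Ident :: "'o \<Rightarrow> 'm"
  Compose :: "'o \<Rightarrow> 'o \<Rightarrow> 'o \<Rightarrow> 'm \<Rightarrow> 'm \<Rightarrow> 'm"

locale category =
  fixes C :: "('o, 'm) cat"
  assumes ident_hom: "X \<in> Obj C \<Longrightarrow> Ident C X \<in> Hom C X X"
    and compose_hom:
      "\<lbrakk>X \<in> Obj C; Y \<in> Obj C; Z \<in> Obj C; f \<in> Hom C X Y; g \<in> Hom C Y Z\<rbrakk>
        \<Longrightarrow> Compose C X Y Z g f \<in> Hom C X Z"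
    and ident_right:
      "\<lbrakk>X \<in> Obj C; Y \<in> Obj C; f \<in> Hom C X Y\<rbrakk> \<Longrightarrow> Compose C X X Y f (Ident C X) = f"
    and ident_left:
      "\<lbrakk>X \<in> Obj C; Y \<in> Obj C; f \<in> Hom C X Y\<rbrakk> \<Longrightarrow> Compose C X Y Y (Ident C Y) f = f"
    and compose_assoc:
      "\<lbrakk>W \<in> Obj C; X \<in> Obj C; Y \<in> Obj C; Z \<in> Obj C;
        f \<in> Hom C W X; g \<in> Hom C X Y; h \<in> Hom C Y Z\<rbrakk>
        \<Longrightarrow> Compose C W Y Z h (Compose C W X Y g f) = Compose C W X Z (Compose C X Y Z h g) f"

record ('o, 'm, 'p, 'n) funct =
  on_obj :: "'o \<Rightarrow> 'p"
  on_mor :: "'o \<Rightarrow> 'o \<Rightarrow> 'm \<Rightarrow> 'n"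

locale is_functor =
  fixes C :: "('o, 'm) cat" and D :: "('p, 'n) cat" and F :: "('o, 'm, 'p, 'n) funct"
  assumes source: "category C"
    and target: "category D"
    and on_obj: "X \<in> Obj C \<Longrightarrow> on_obj F X \<in> Obj D"
    and on_mor: "\<lbrakk>X \<in> Obj C; Y \<in> Obj C; f \<in> Hom C X Y\<rbrakk>
        \<Longrightarrow> on_mor F X Y f \<in> Hom D (on_obj F X) (on_obj F Y)"
    and on_ident: "X \<in> Obj C \<Longrightarrow> on_mor F X X (Ident C X) = Ident D (on_obj F X)"
    and on_compose:
      "\<lbrakk>X \<in> Obj C; Y \<in> Obj C; Z \<in> Obj C; f \<in> Hom C X Y; g \<in> Hom C Y Z\<rbrakk>
        \<Longrightarrow> on_mor F X Z (Compose C X Y Z g f) =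
          Compose D (on_obj F X) (on_obj F Y) (on_obj F Z) (on_mor F Y Z g) (on_mor F X Y f)"

definition id_funct :: "('o, 'm, 'o, 'm) funct" where
  "id_funct = \<lparr>on_obj = (\<lambda>X. X), on_mor = (\<lambda>X Y f. f)\<rparr>"

definition comp_funct ::
  "('p, 'n, 'q, 'l) funct \<Rightarrow> ('o, 'm, 'p, 'n) funct \<Rightarrow> ('o, 'm, 'q, 'l) funct" where
  "comp_funct G F =
    \<lparr>on_obj = (\<lambda>X. on_obj G (on_obj F X)),
     on_mor = (\<lambda>X Y f. on_mor G (on_obj F X) (on_obj F Y) (on_mor F X Y f))\<rparr>"

definition is_nat_trans ::
  "('o, 'm) cat \<Rightarrow> ('p, 'n) cat \<Rightarrow> ('o, 'm, 'p, 'n) funct \<Rightarrow> ('o, 'm, 'p, 'n) funct \<Rightarrow> ('o \<Rightarrow> 'n) \<Rightarrow> bool" where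
  "is_nat_trans C D F G \<alpha> \<longleftrightarrow>
    is_functor C D F \<and> is_functor C D G \<and>
    (\<forall>X\<in>Obj C. \<alpha> X \<in> Hom D (on_obj F X) (on_obj G X)) \<and>
    (\<forall>X\<in>Obj C. \<forall>Y\<in>Obj C. \<forall>f\<in>Hom C X Y.
      Compose D (on_obj F X) (on_obj F Y) (on_obj G Y) (\<alpha> Y) (on_mor F X Y f) =
      Compose D (on_obj F X) (on_obj G X) (on_obj G Y) (on_mor G X Y f) (\<alpha> X))"

definition is_iso :: "('o, 'm) cat \<Rightarrow> 'o \<Rightarrow> 'o \<Rightarrow> 'm \<Rightarrow> bool" where
  "is_iso C X Y f \<longleftrightarrow> f \<in> Hom C X Y \<and>
    (\<exists>g\<in>Hom C Y X. Compose C X Y X g f = Ident C X \<and> Compose C Y X Y f g = Ident C Y)"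

definition is_nat_iso ::
  "('o, 'm) cat \<Rightarrow> ('p, 'n) cat \<Rightarrow> ('o, 'm, 'p, 'n) funct \<Rightarrow> ('o, 'm, 'p, 'n) funct \<Rightarrow> ('o \<Rightarrow> 'n) \<Rightarrow> bool" where
  "is_nat_iso C D F G \<alpha> \<longleftrightarrow> is_nat_trans C D F G \<alpha> \<and>
    (\<forall>X\<in>Obj C. is_iso D (on_obj F X) (on_obj G X) (\<alpha> X))"

definition is_equivalence :: "('o, 'm) cat \<Rightarrow> ('p, 'n) cat \<Rightarrow> ('o, 'm, 'p, 'n) funct \<Rightarrow> bool" where
  "is_equivalence C D F \<longleftrightarrow> is_functor C D F \<and>
    (\<exists>G \<alpha> \<beta>. is_functor D C G \<and>
      is_nat_iso C C id_funct (comp_funct G F) \<alpha> \<and>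
      is_nat_iso D D (comp_funct F G) id_funct \<beta>)"

definition equivalent_categories :: "('o, 'm) cat \<Rightarrow> ('p, 'n) cat \<Rightarrow> bool" where
  "equivalent_categories C D \<longleftrightarrow> (\<exists>F. is_equivalence C D F)"

definition coslice :: "('o, 'm) cat \<Rightarrow> 'o \<Rightarrow> ('o \<times> 'm, 'm) cat" where
  "coslice C A =
    \<lparr>Obj = {(X, \<mu>). X \<in> Obj C \<and> \<mu> \<in> Hom C A X},
     Hom = (\<lambda>(X, \<mu>) (Y, \<kappa>). {f \<in> Hom C X Y. Compose C A X Y f \<mu> = \<kappa>}),
     Ident = (\<lambda>(X, \<mu>). Ident C X),
     Compose = (\<lambda>(X, \<mu>) (Y, \<kappa>) (Z, \<nu>). Compose C X Y Z)\<rparr>"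

(* F : C -> D is left adjoint to U : D -> C with unit \<eta> and counit \<epsilon>. *)
definition is_adjunction ::
  "('o, 'm) cat \<Rightarrow> ('p, 'n) cat \<Rightarrow> ('o, 'm, 'p, 'n) funct \<Rightarrow> ('p, 'n, 'o, 'm) funct \<Rightarrow>
    ('o \<Rightarrow> 'm) \<Rightarrow> ('p \<Rightarrow> 'n) \<Rightarrow> bool" where
  "is_adjunction C D F U \<eta> \<epsilon> \<longleftrightarrow>
    is_functor C D F \<and> is_functor D C U \<and>
    is_nat_trans C C id_funct (comp_funct U F) \<eta> \<and>
    is_nat_trans D D (comp_funct F U) id_funct \<epsilon> \<and>
    (\<forall>X\<in>Obj C.
      Compose D (on_obj F X) (on_obj F (on_obj U (on_obj F X))) (on_obj F X)
        (\<epsilon> (on_obj F X)) (on_mor F X (on_obj U (on_obj F X)) (\<eta> X)) = Ident D (on_obj F X)) \<and>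
    (\<forall>Y\<in>Obj D.
      Compose C (on_obj U Y) (on_obj U (on_obj F (on_obj U Y))) (on_obj U Y)
        (on_mor U (on_obj F (on_obj U Y)) Y (\<epsilon> Y)) (\<eta> (on_obj U Y)) = Ident C (on_obj U Y))"

definition eilenberg_moore ::
  "('o, 'm) cat \<Rightarrow> ('o, 'm, 'o, 'm) funct \<Rightarrow> ('o \<Rightarrow> 'm) \<Rightarrow> ('o \<Rightarrow> 'm) \<Rightarrow> ('o \<times> 'm, 'm) cat" where
  "eilenberg_moore C T \<eta> \<mu> =
    \<lparr>Obj = {(A, a). A \<in> Obj C \<and> a \<in> Hom C (on_obj T A) A \<and>
        Compose C A (on_obj T A) A a (\<eta> A) = Ident C A \<and>
        Compose C (on_obj T (on_obj T A)) (on_obj T A) A a (\<mu> A) =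
        Compose C (on_obj T (on_obj T A)) (on_obj T A) A a (on_mor T (on_obj T A) A a)},
     Hom = (\<lambda>(A, a) (B, b). {f \<in> Hom C A B.
        Compose C (on_obj T A) A B f a =
        Compose C (on_obj T A) (on_obj T B) B b (on_mor T A B f)}),
     Ident = (\<lambda>(A, a). Ident C A),
     Compose = (\<lambda>(A, a) (B, b) (D, d). Compose C A B D)\<rparr>"

definition induced_mult ::
  "('o, 'm, 'p, 'n) funct \<Rightarrow> ('p, 'n, 'o, 'm) funct \<Rightarrow> ('p \<Rightarrow> 'n) \<Rightarrow> 'o \<Rightarrow> 'm" where
  "induced_mult F U \<epsilon> X =
    on_mor U (on_obj F (on_obj U (on_obj F X))) (on_obj F X) (\<epsilon> (on_obj F X))"

definition comparison ::
  "('o, 'm, 'p, 'n) funct \<Rightarrow> ('p, 'n, 'o, 'm) funct \<Rightarrow> ('p \<Rightarrow> 'n) \<Rightarrow> ('p, 'n, 'o \<times> 'm, 'm) funct" where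
  "comparison F U \<epsilon> =
    \<lparr>on_obj = (\<lambda>Y. (on_obj U Y, on_mor U (on_obj F (on_obj U Y)) Y (\<epsilon> Y))),
     on_mor = on_mor U\<rparr>"

definition monadic :: "('o, 'm) cat \<Rightarrow> ('p, 'n) cat \<Rightarrow> ('p, 'n, 'o, 'm) funct \<Rightarrow> bool" where
  "monadic C D U \<longleftrightarrow>
    (\<exists>F \<eta> \<epsilon>. is_adjunction C D F U \<eta> \<epsilon> \<and>
      is_equivalence D (eilenberg_moore C (comp_funct U F) \<eta> (induced_mult F U \<epsilon>))
        (comparison F U \<epsilon>))"


(* The tensor is written * and the unit k is 1. *)
class comm_quantale = complete_lattice + comm_monoid_mult +
  assumes mult_Sup: "p * Sup A = (SUP q\<in>A. p * q)"

(* Functions on X \<times> Y are extensional (undefined elsewhere), so equality and the pointwise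
   order of Q-relations are the ambient = and \<le>. *)
definition qrel :: "'a set \<Rightarrow> 'b set \<Rightarrow> ('a \<times> 'b \<Rightarrow> 'q::comm_quantale) set" where
  "qrel X Y = X \<times> Y \<rightarrow>\<^sub>E UNIV"

definition qid :: "'a set \<Rightarrow> 'a \<times> 'a \<Rightarrow> 'q::comm_quantale" where
  "qid X = (\<lambda>(x, y)\<in>X \<times> X. if x = y then 1 else bot)"

definition qcomp ::
  "'a set \<Rightarrow> 'b set \<Rightarrow> 'c set \<Rightarrow> ('b \<times> 'c \<Rightarrow> 'q) \<Rightarrow> ('a \<times> 'b \<Rightarrow> 'q) \<Rightarrow> 'a \<times> 'c \<Rightarrow> 'q::comm_quantale" where
  "qcomp X Y Z \<psi> \<phi> = (\<lambda>(x, z)\<in>X \<times> Z. SUP y\<in>Y. \<psi> (y, z) * \<phi> (x, y))"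

definition qmap :: "'a set \<Rightarrow> 'b set \<Rightarrow> ('a \<times> 'b \<Rightarrow> 'q::comm_quantale) set" where
  "qmap X Y = {\<zeta> \<in> qrel X Y.
    \<exists>\<eta>\<in>qrel Y X. qid X \<le> qcomp X Y X \<eta> \<zeta> \<and> qcomp Y X Y \<zeta> \<eta> \<le> qid Y}"

(* A universe of sets: a collection \<U> of subsets of a type 'u, with a fixed point star and an
   embedding inl of 'u avoiding it, so that X_+ can be formed inside 'u.  For an infinite type
   one may take all its subsets; for a type of all ZF sets, one may take its small subsets. *)
locale set_universe =
  fixes \<U> :: "'u set set" and inl :: "'u \<Rightarrow> 'u" and star :: 'u
  assumes inj_inl: "inj inl"
    and star_inl: "star \<notin> range inl"
    and empty_in: "{} \<in> \<U>"
    and subset_in: "\<lbrakk>X \<in> \<U>; Y \<subseteq> X\<rbrakk> \<Longrightarrow> Y \<in> \<U>"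
    and plus_in: "X \<in> \<U> \<Longrightarrow> insert star (inl ` X) \<in> \<U>"

definition plus_pt :: "('u \<Rightarrow> 'u) \<Rightarrow> 'u \<Rightarrow> 'u set \<Rightarrow> 'u set" where
  "plus_pt inl star X = insert star (inl ` X)"

definition QMap :: "'u set set \<Rightarrow> ('u set, 'u \<times> 'u \<Rightarrow> 'q::comm_quantale) cat" where
  "QMap \<U> = \<lparr>Obj = \<U>, Hom = qmap, Ident = qid, Compose = qcomp\<rparr>"

definition pid :: "('u \<Rightarrow> 'u) \<Rightarrow> 'u \<Rightarrow> 'u set \<Rightarrow> 'u \<times> 'u \<Rightarrow> 'q::comm_quantale" where
  "pid inl star X = (\<lambda>(x, w)\<in>X \<times> plus_pt inl star X. if w = inl x then 1 else bot)"

definition pcomp ::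
  "('u \<Rightarrow> 'u) \<Rightarrow> 'u \<Rightarrow> 'u set \<Rightarrow> 'u set \<Rightarrow> 'u set \<Rightarrow>
    ('u \<times> 'u \<Rightarrow> 'q) \<Rightarrow> ('u \<times> 'u \<Rightarrow> 'q) \<Rightarrow> 'u \<times> 'u \<Rightarrow> 'q::comm_quantale" where
  "pcomp inl star X Y Z \<eta> \<zeta> = (\<lambda>(x, w)\<in>X \<times> plus_pt inl star Z.
    if w = star then sup (SUP y\<in>Y. \<eta> (y, star) * \<zeta> (x, inl y)) (\<zeta> (x, star))
    else (SUP y\<in>Y. \<eta> (y, w) * \<zeta> (x, inl y)))"

definition PQMap ::
  "'u set set \<Rightarrow> ('u \<Rightarrow> 'u) \<Rightarrow> 'u \<Rightarrow> ('u set, 'u \<times> 'u \<Rightarrow> 'q::comm_quantale) cat" where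
  "PQMap \<U> inl star =
    \<lparr>Obj = \<U>,
     Hom = (\<lambda>X Y. qmap X (plus_pt inl star Y)),
     Ident = pid inl star,
     Compose = pcomp inl star\<rparr>"

definition U_T ::
  "('u \<Rightarrow> 'u) \<Rightarrow> 'u \<Rightarrow>
    ('u set, 'u \<times> 'u \<Rightarrow> 'q, 'u set, 'u \<times> 'u \<Rightarrow> 'q::comm_quantale) funct" where
  "U_T inl star =
    \<lparr>on_obj = plus_pt inl star,
     on_mor = (\<lambda>X Y \<zeta>. \<lambda>(v, w)\<in>plus_pt inl star X \<times> plus_pt inl star Y.
       if v = star then (if w = star then 1 else bot) else \<zeta> (inv inl v, w))\<rparr>"

end

theory Submission
  imports Defs
begin

text \<open>
  The category of sets and \<open>Q\<close>-maps has coproducts \<open>X\<^sub>+\<close> of a set \<open>X\<close> with the singleton, because a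
  \<open>Q\<close>-map out of \<open>X\<close> is just an \<open>X\<close>-indexed family of rows, each being a \<open>Q\<close>-map out of a point.  In any
  category with such coproducts, the Kleisli category of the maybe monad is the full subcategory of
  the coslice on the free pointed objects (\<open>coslice_full\<close>, \<open>U_faithful\<close>), and algebras of the monad are
  the same as pointed objects (\<open>algebra_morphism_iff\<close>).  So both the embedding into the coslice and
  the comparison functor are fully faithful, and both claims reduce to essential surjectivity: every
  pointed object must be isomorphic to a free one.

  This is \<open>point_complement\<close>, the part that is special to quantales.  A point \<open>\<mu>\<close> of \<open>X\<close> with right adjoint
  \<open>\<kappa>\<close> need not be an element of \<open>X\<close>: it splits the unit into orthogonal idempotents
  \<open>e x = \<kappa> x * \<mu> x\<close> with supremum \<open>1\<close>, and on the piece \<open>e x\<close> it agrees, up to an invertible factor,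
  with the element \<open>x\<close>.  Since the quantale is non-trivial, \<open>X\<close> has some element \<open>x0\<close>.  Transposing \<open>x0\<close>
  and \<open>x\<close> on each piece \<open>e x\<close> defines an automorphism of \<open>X\<close> that carries \<open>x0\<close> to \<open>\<mu>\<close>
  (\<open>adjoint_point_match\<close>), and \<open>X\<close> pointed at \<open>x0\<close> is \<open>(X - {x0})\<^sub>+\<close>.  The axiom of choice selects the
  elements \<open>x0\<close> and the isomorphisms when a quasi-inverse is formed
  (\<open>equivalence_of_full_faithful_dense\<close>).
\<close>

section \<open>Functors and equivalences\<close>

lemma functor_id: "category C \<Longrightarrow> is_functor C C id_funct"
  by (auto simp: is_functor_def id_funct_def)

lemma functor_comp:
  assumes "is_functor C D F" "is_functor D E G"
  shows "is_functor C E (comp_funct G F)"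
proof -
  interpret F: is_functor C D F by fact
  interpret G: is_functor D E G by fact
  show ?thesis
    by (auto simp: is_functor_def comp_funct_def F.source G.target F.on_obj F.on_mor F.on_ident F.on_compose
        G.on_obj G.on_mor G.on_ident G.on_compose)
qed

text \<open>A quasi-inverse sends \<open>Y\<close> to a chosen \<open>g Y\<close> with \<open>F (g Y) \<cong> Y\<close>, and a morphism \<open>h\<close> to the
  unique preimage under \<open>F\<close> of its conjugate \<open>e' h e\<close> by the chosen isomorphisms.  These isomorphisms are the counit by
  construction, and the unit is the preimage of their inverses.\<close>

lemma equivalence_of_full_faithful_dense:
  assumes F: "is_functor C D F"
    and full: "\<And>X Y h. \<lbrakk>X \<in> Obj C; Y \<in> Obj C; h \<in> Hom D (on_obj F X) (on_obj F Y)\<rbrakk>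
      \<Longrightarrow> \<exists>f\<in>Hom C X Y. on_mor F X Y f = h"
    and faithful: "\<And>X Y f f'. \<lbrakk>X \<in> Obj C; Y \<in> Obj C; f \<in> Hom C X Y; f' \<in> Hom C X Y;
        on_mor F X Y f = on_mor F X Y f'\<rbrakk> \<Longrightarrow> f = f'"
    and dense: "\<And>Y. Y \<in> Obj D \<Longrightarrow> \<exists>X\<in>Obj C. \<exists>e. is_iso D (on_obj F X) Y e"
  shows "is_equivalence C D F"
proof -
  interpret F: is_functor C D F by (rule F)
  interpret C: category C by (rule F.source)
  interpret D: category D by (rule F.target)
  have "\<forall>Y\<in>Obj D. \<exists>X e e'. X \<in> Obj C \<and> e \<in> Hom D (on_obj F X) Y \<and> e' \<in> Hom D Y (on_obj F X) \<and>
      Compose D (on_obj F X) Y (on_obj F X) e' e = Ident D (on_obj F X) \<and>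
      Compose D Y (on_obj F X) Y e e' = Ident D Y"
    using dense unfolding is_iso_def by blast
  then obtain g e e' where g: "\<And>Y. Y \<in> Obj D \<Longrightarrow> g Y \<in> Obj C"
    and e: "\<And>Y. Y \<in> Obj D \<Longrightarrow> e Y \<in> Hom D (on_obj F (g Y)) Y"
    and e': "\<And>Y. Y \<in> Obj D \<Longrightarrow> e' Y \<in> Hom D Y (on_obj F (g Y))"
    and e'e: "\<And>Y. Y \<in> Obj D \<Longrightarrow>
      Compose D (on_obj F (g Y)) Y (on_obj F (g Y)) (e' Y) (e Y) = Ident D (on_obj F (g Y))"
    and ee': "\<And>Y. Y \<in> Obj D \<Longrightarrow> Compose D Y (on_obj F (g Y)) Y (e Y) (e' Y) = Ident D Y"
    by metis
  define lift where "lift X Y h = (SOME f. f \<in> Hom C X Y \<and> on_mor F X Y f = h)" for X Y h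
  have lift: "lift X Y h \<in> Hom C X Y \<and> on_mor F X Y (lift X Y h) = h"
    if "X \<in> Obj C" "Y \<in> Obj C" "h \<in> Hom D (on_obj F X) (on_obj F Y)" for X Y h
    unfolding lift_def by (rule someI_ex) (use full[OF that] in blast)
  note lift_hom = lift[THEN conjunct1] and F_lift = lift[THEN conjunct2]
  define conj_by where "conj_by Y Z h =
    Compose D (on_obj F (g Y)) Z (on_obj F (g Z)) (e' Z) (Compose D (on_obj F (g Y)) Y Z h (e Y))" for Y Z h
  define G where "G = \<lparr>on_obj = g, on_mor = (\<lambda>Y Z h. lift (g Y) (g Z) (conj_by Y Z h))\<rparr>"
  define \<alpha> where "\<alpha> X = lift X (g (on_obj F X)) (e' (on_obj F X))" for X
  note obs = g F.on_obj
  have conj_hom: "conj_by Y Z h \<in> Hom D (on_obj F (g Y)) (on_obj F (g Z))"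
    if "Y \<in> Obj D" "Z \<in> Obj D" "h \<in> Hom D Y Z" for Y Z h
    unfolding conj_by_def using that by (intro D.compose_hom e e' obs) auto
  have conj_e: "Compose D (on_obj F (g Y)) (on_obj F (g Z)) Z (e Z) (conj_by Y Z h) =
      Compose D (on_obj F (g Y)) Y Z h (e Y)"
    if "Y \<in> Obj D" "Z \<in> Obj D" "h \<in> Hom D Y Z" for Y Z h
  proof -
    have he: "Compose D (on_obj F (g Y)) Y Z h (e Y) \<in> Hom D (on_obj F (g Y)) Z"
      using that by (intro D.compose_hom e obs) auto
    show ?thesis unfolding conj_by_def
      using that he by (subst D.compose_assoc) (auto simp: ee' obs e e' D.ident_left)
  qed
  have G: "is_functor D C G"
  proof
    fix Y assume Y: "Y \<in> Obj D"
    show "on_obj G Y \<in> Obj C" using g[OF Y] by (simp add: G_def)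
    have "conj_by Y Y (Ident D Y) = Ident D (on_obj F (g Y))"
      unfolding conj_by_def using Y by (simp add: D.ident_left[OF _ _ e] obs e'e)
    then show "on_mor G Y Y (Ident D Y) = Ident C (on_obj G Y)"
      using Y F_lift[OF g[OF Y] g[OF Y] D.ident_hom[OF F.on_obj[OF g[OF Y]]]]
      by (auto simp: G_def F.on_ident g F.on_obj intro!: faithful[of "g Y" "g Y"] lift_hom obs C.ident_hom D.ident_hom)
  next
    fix X Y f assume "X \<in> Obj D" "Y \<in> Obj D" "f \<in> Hom D X Y"
    then show "on_mor G X Y f \<in> Hom C (on_obj G X) (on_obj G Y)"
      by (auto simp: G_def intro!: lift_hom obs conj_hom)
  next
    fix X Y Z m n assume as: "X \<in> Obj D" "Y \<in> Obj D" "Z \<in> Obj D" "m \<in> Hom D X Y" "n \<in> Hom D Y Z"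
    let ?F = "\<lambda>Y. on_obj F (g Y)"
    have F: "?F X \<in> Obj D" "?F Y \<in> Obj D" "?F Z \<in> Obj D" using as by (auto intro: obs)
    have me: "Compose D (?F X) X Y m (e X) \<in> Hom D (?F X) Y"
      using as F by (intro D.compose_hom e) auto
    have ne: "Compose D (?F Y) Y Z n (e Y) \<in> Hom D (?F Y) Z"
      using as F by (intro D.compose_hom e) auto
    have k: "conj_by X Y m \<in> Hom D (?F X) (?F Y)" "conj_by Y Z n \<in> Hom D (?F Y) (?F Z)"
      using as by (auto intro: conj_hom)
    have "Compose D (?F X) (?F Y) (?F Z) (conj_by Y Z n) (conj_by X Y m) =
        Compose D (?F X) Z (?F Z) (e' Z)
          (Compose D (?F X) (?F Y) Z (Compose D (?F Y) Y Z n (e Y)) (conj_by X Y m))"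
      unfolding conj_by_def[of Y Z]
      using D.compose_assoc[OF F(1,2) as(3) F(3) k(1) ne e'[OF as(3)]] by simp
    also have "Compose D (?F X) (?F Y) Z (Compose D (?F Y) Y Z n (e Y)) (conj_by X Y m) =
        Compose D (?F X) Y Z n (Compose D (?F X) X Y m (e X))"
      using D.compose_assoc[OF F(1,2) as(2,3) k(1) e[OF as(2)] as(5)] conj_e[OF as(1,2,4)] by simp
    also have "\<dots> = Compose D (?F X) X Z (Compose D X Y Z n m) (e X)"
      using D.compose_assoc[OF F(1) as(1-3) e[OF as(1)] as(4,5)] .
    finally have "conj_by X Z (Compose D X Y Z n m) =
        Compose D (?F X) (?F Y) (?F Z) (conj_by Y Z n) (conj_by X Y m)"
      by (simp add: conj_by_def)
    moreover have "Compose D X Y Z n m \<in> Hom D X Z" using as by (intro D.compose_hom)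
    moreover have "Compose D (?F X) (?F Y) (?F Z) (conj_by Y Z n) (conj_by X Y m) \<in> Hom D (?F X) (?F Z)"
      using F k by (intro D.compose_hom)
    ultimately show "on_mor G X Z (Compose D X Y Z n m) =
        Compose C (on_obj G X) (on_obj G Y) (on_obj G Z) (on_mor G Y Z n) (on_mor G X Y m)"
      using as k by (auto simp: G_def F_lift F.on_compose g lift_hom conj_hom
          intro!: faithful[of "g X" "g Z"] C.compose_hom)
  qed
  note GF = functor_comp[OF F G] and FG = functor_comp[OF G F]
    and idC = functor_id[OF F.source] and idD = functor_id[OF F.target]
  have \<alpha>_hom: "\<alpha> X \<in> Hom C X (g (on_obj F X))" and F\<alpha>: "on_mor F X (g (on_obj F X)) (\<alpha> X) = e' (on_obj F X)"
    if "X \<in> Obj C" for X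
    using that by (auto simp: \<alpha>_def intro!: lift_hom F_lift obs e')
  have "is_nat_iso C C id_funct (comp_funct G F) \<alpha>"
    unfolding is_nat_iso_def is_nat_trans_def
  proof (intro conjI ballI idC GF)
    fix X assume X: "X \<in> Obj C"
    let ?gF = "g (on_obj F X)"
    show "\<alpha> X \<in> Hom C (on_obj id_funct X) (on_obj (comp_funct G F) X)"
      using \<alpha>_hom[OF X] by (simp add: id_funct_def comp_funct_def G_def)
    let ?b = "lift ?gF X (e (on_obj F X))"
    have b: "?b \<in> Hom C ?gF X" "on_mor F ?gF X ?b = e (on_obj F X)"
      using X by (auto intro!: lift_hom F_lift obs e)
    have "Compose C X ?gF X ?b (\<alpha> X) = Ident C X"
      using X b \<alpha>_hom[OF X] by (intro faithful[of X X])
        (auto simp: F.on_compose F.on_ident F\<alpha> obs ee' intro!: C.compose_hom C.ident_hom)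
    moreover have "Compose C ?gF X ?gF (\<alpha> X) ?b = Ident C ?gF"
      using X b \<alpha>_hom[OF X] by (intro faithful[of ?gF ?gF])
        (auto simp: F.on_compose F.on_ident F\<alpha> obs e'e intro!: C.compose_hom C.ident_hom)
    ultimately show "is_iso C (on_obj id_funct X) (on_obj (comp_funct G F) X) (\<alpha> X)"
      using \<alpha>_hom[OF X] b by (auto simp: is_iso_def id_funct_def comp_funct_def G_def)
  next
    fix X Y f assume as: "X \<in> Obj C" "Y \<in> Obj C" "f \<in> Hom C X Y"
    let ?X = "on_obj F X" and ?Y = "on_obj F Y" and ?f = "on_mor F X Y f"
    have o: "?X \<in> Obj D" "?Y \<in> Obj D" "g ?X \<in> Obj C" "g ?Y \<in> Obj C"
      "on_obj F (g ?X) \<in> Obj D" "on_obj F (g ?Y) \<in> Obj D" and f: "?f \<in> Hom D ?X ?Y"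
      using as by (auto intro: obs F.on_mor)
    have fe: "Compose D (on_obj F (g ?X)) ?X ?Y ?f (e ?X) \<in> Hom D (on_obj F (g ?X)) ?Y"
      using as o f by (intro D.compose_hom e)
    have "Compose D ?X (on_obj F (g ?X)) (on_obj F (g ?Y)) (conj_by ?X ?Y ?f) (e' ?X) =
        Compose D ?X ?Y (on_obj F (g ?Y)) (e' ?Y) ?f"
      unfolding conj_by_def
      using o f fe
      by (simp add: D.compose_assoc[of _ _ ?Y, symmetric] D.compose_assoc[of _ _ ?X, symmetric]
          D.ident_right e e' ee')
    then have "Compose C X Y (g ?Y) (\<alpha> Y) f = Compose C X (g ?X) (g ?Y) (lift (g ?X) (g ?Y) (conj_by ?X ?Y ?f)) (\<alpha> X)"
      using as o f by (intro faithful[of X "g ?Y"])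
        (auto simp: F.on_compose F\<alpha> F_lift \<alpha>_hom lift_hom conj_hom intro!: C.compose_hom)
    then show "Compose C (on_obj id_funct X) (on_obj id_funct Y) (on_obj (comp_funct G F) Y) (\<alpha> Y) (on_mor id_funct X Y f) =
        Compose C (on_obj id_funct X) (on_obj (comp_funct G F) X) (on_obj (comp_funct G F) Y) (on_mor (comp_funct G F) X Y f) (\<alpha> X)"
      by (simp add: id_funct_def comp_funct_def G_def)
  qed
  moreover have "is_nat_iso D D (comp_funct F G) id_funct e"
    unfolding is_nat_iso_def is_nat_trans_def
  proof (intro conjI ballI idD FG)
    fix Y assume "Y \<in> Obj D"
    then show "is_iso D (on_obj (comp_funct F G) Y) (on_obj id_funct Y) (e Y)"
      using e e' e'e ee' by (auto simp: is_iso_def id_funct_def comp_funct_def G_def intro!: bexI[of _ "e' Y"])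
  qed (simp_all add: id_funct_def comp_funct_def G_def F_lift obs e conj_hom conj_e)
  ultimately show ?thesis
    unfolding is_equivalence_def using F G by blast
qed

section \<open>Coslices, algebras and the comparison functor\<close>

lemma category_coslice:
  assumes "category C" "A \<in> Obj C"
  shows "category (coslice C A)"
proof -
  interpret category C by fact
  show ?thesis
    using assms(2)
    by unfold_locales
      (auto simp: coslice_def ident_hom compose_hom ident_left ident_right compose_assoc[symmetric]
        intro: compose_assoc)
qed

lemma category_eilenberg_moore:
  assumes T: "is_functor C C T"
  shows "category (eilenberg_moore C T \<eta> \<mu>)"
proof -
  interpret T: is_functor C C T by (rule T)
  interpret category C by (rule T.source)
  show ?thesis
  proof
    fix X Y Z f g
    assume as: "X \<in> Obj (eilenberg_moore C T \<eta> \<mu>)" "Y \<in> Obj (eilenberg_moore C T \<eta> \<mu>)"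
      "Z \<in> Obj (eilenberg_moore C T \<eta> \<mu>)" "f \<in> Hom (eilenberg_moore C T \<eta> \<mu>) X Y"
      "g \<in> Hom (eilenberg_moore C T \<eta> \<mu>) Y Z"
    obtain A a B b D d where XYZ: "X = (A, a)" "Y = (B, b)" "Z = (D, d)"
      by (cases X, cases Y, cases Z)
    have o: "A \<in> Obj C" "B \<in> Obj C" "D \<in> Obj C"
      and s: "a \<in> Hom C (on_obj T A) A" "b \<in> Hom C (on_obj T B) B" "d \<in> Hom C (on_obj T D) D"
      and f: "f \<in> Hom C A B" "Compose C (on_obj T A) A B f a =
        Compose C (on_obj T A) (on_obj T B) B b (on_mor T A B f)"
      and g: "g \<in> Hom C B D" "Compose C (on_obj T B) B D g b =
        Compose C (on_obj T B) (on_obj T D) D d (on_mor T B D g)"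
      using as by (auto simp: XYZ eilenberg_moore_def)
    note ot = o[THEN T.on_obj]
    have Tf: "on_mor T A B f \<in> Hom C (on_obj T A) (on_obj T B)"
      and Tg: "on_mor T B D g \<in> Hom C (on_obj T B) (on_obj T D)"
      using o f g by (auto intro: T.on_mor)
    have "Compose C (on_obj T A) A D (Compose C A B D g f) a =
        Compose C (on_obj T A) B D g (Compose C (on_obj T A) A B f a)"
      using compose_assoc[OF ot(1) o s(1) f(1) g(1)] by simp
    also have "\<dots> = Compose C (on_obj T A) (on_obj T B) D (Compose C (on_obj T B) B D g b) (on_mor T A B f)"
      using compose_assoc[OF ot(1,2) o(2,3) Tf s(2) g(1)] f by simp
    also have "\<dots> = Compose C (on_obj T A) (on_obj T D) D d (on_mor T A D (Compose C A B D g f))"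
      using compose_assoc[OF ot o(3) Tf Tg s(3)] g f o by (simp add: T.on_compose)
    finally show "Compose (eilenberg_moore C T \<eta> \<mu>) X Y Z g f \<in> Hom (eilenberg_moore C T \<eta> \<mu>) X Z"
      using o f g by (simp add: XYZ eilenberg_moore_def compose_hom)
  qed (auto simp: eilenberg_moore_def ident_hom ident_left ident_right T.on_ident T.on_obj compose_assoc)
qed

text \<open>Naturality of the counit at \<open>f\<close>, pushed through \<open>U\<close>, carries everything: at a morphism of the
  form \<open>\<epsilon> Y\<close> it is the associativity law of the algebra \<open>U (\<epsilon> Y)\<close>, at a general \<open>f\<close> it says
  that \<open>U f\<close> is an algebra homomorphism.  The unit law is a triangle identity.\<close>

lemma functor_comparison:
  assumes adj: "is_adjunction C D F U \<eta> \<epsilon>"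
  shows "is_functor D (eilenberg_moore C (comp_funct U F) \<eta> (induced_mult F U \<epsilon>)) (comparison F U \<epsilon>)"
proof -
  interpret F: is_functor C D F using adj by (simp add: is_adjunction_def)
  interpret U: is_functor D C U using adj by (simp add: is_adjunction_def)
  have \<epsilon>: "\<epsilon> Y \<in> Hom D (on_obj F (on_obj U Y)) Y" if "Y \<in> Obj D" for Y
    using adj that by (simp add: is_adjunction_def is_nat_trans_def comp_funct_def id_funct_def)
  have nat: "Compose D (on_obj F (on_obj U X)) (on_obj F (on_obj U Y)) Y (\<epsilon> Y)
        (on_mor F (on_obj U X) (on_obj U Y) (on_mor U X Y f)) =
      Compose D (on_obj F (on_obj U X)) X Y f (\<epsilon> X)"
    if "X \<in> Obj D" "Y \<in> Obj D" "f \<in> Hom D X Y" for X Y f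
    using adj that by (simp add: is_adjunction_def is_nat_trans_def comp_funct_def id_funct_def)
  have U_nat: "Compose C (on_obj U (on_obj F (on_obj U X))) (on_obj U (on_obj F (on_obj U Y))) (on_obj U Y)
        (on_mor U (on_obj F (on_obj U Y)) Y (\<epsilon> Y))
        (on_mor U (on_obj F (on_obj U X)) (on_obj F (on_obj U Y))
          (on_mor F (on_obj U X) (on_obj U Y) (on_mor U X Y f))) =
      Compose C (on_obj U (on_obj F (on_obj U X))) (on_obj U X) (on_obj U Y)
        (on_mor U X Y f) (on_mor U (on_obj F (on_obj U X)) X (\<epsilon> X))"
    if "X \<in> Obj D" "Y \<in> Obj D" "f \<in> Hom D X Y" for X Y f
    using that nat[OF that]
    by (simp add: U.on_compose[symmetric] U.on_obj U.on_mor F.on_obj F.on_mor \<epsilon>)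
  have tri: "Compose C (on_obj U Y) (on_obj U (on_obj F (on_obj U Y))) (on_obj U Y)
        (on_mor U (on_obj F (on_obj U Y)) Y (\<epsilon> Y)) (\<eta> (on_obj U Y)) = Ident C (on_obj U Y)"
    if "Y \<in> Obj D" for Y
    using adj that by (simp add: is_adjunction_def)
  have mult: "Compose C (on_obj U (on_obj F (on_obj U (on_obj F (on_obj U Y))))) (on_obj U (on_obj F (on_obj U Y)))
        (on_obj U Y) (on_mor U (on_obj F (on_obj U Y)) Y (\<epsilon> Y)) (induced_mult F U \<epsilon> (on_obj U Y)) =
      Compose C (on_obj U (on_obj F (on_obj U (on_obj F (on_obj U Y))))) (on_obj U (on_obj F (on_obj U Y)))
        (on_obj U Y) (on_mor U (on_obj F (on_obj U Y)) Y (\<epsilon> Y))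
        (on_mor U (on_obj F (on_obj U (on_obj F (on_obj U Y)))) (on_obj F (on_obj U Y))
          (on_mor F (on_obj U (on_obj F (on_obj U Y))) (on_obj U Y) (on_mor U (on_obj F (on_obj U Y)) Y (\<epsilon> Y))))"
    if "Y \<in> Obj D" for Y
    unfolding induced_mult_def
    using that by (intro U_nat[symmetric] \<epsilon>) (auto simp: F.on_obj U.on_obj)
  have UF: "is_functor C C (comp_funct U F)"
    by (rule functor_comp) (rule F.is_functor_axioms U.is_functor_axioms)+
  show ?thesis
    using tri mult U_nat
    by (simp add: is_functor_def U.source category_eilenberg_moore[OF UF])
      (simp add: eilenberg_moore_def comparison_def comp_funct_def U.on_obj U.on_mor F.on_obj \<epsilon>
        U.on_ident U.on_compose)
qed

section \<open>The maybe monad of a category with coproducts by a fixed object\<close>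

text \<open>The object \<open>plus X\<close> is a coproduct of \<open>X\<close> and \<open>A\<close>, with injections \<open>incl X\<close> and \<open>pt X\<close>; \<open>copair\<close>
  and \<open>plus_ext\<close> are existence and uniqueness in its universal property.  The Kleisli category \<open>P\<close> and
  its right adjoint \<open>U\<close> enter as parameters constrained only on actual morphisms, so that a
  category whose composition is given by an explicit formula can be used directly.\<close>

locale maybe_coproduct = category C for C :: "('o, 'm) cat" +
  fixes A :: 'o and plus :: "'o \<Rightarrow> 'o" and incl :: "'o \<Rightarrow> 'm" and pt :: "'o \<Rightarrow> 'm"
    and copair :: "'o \<Rightarrow> 'o \<Rightarrow> 'm \<Rightarrow> 'm \<Rightarrow> 'm"
    and P :: "('o, 'm) cat" and U :: "('o, 'm, 'o, 'm) funct"
  assumes A_obj: "A \<in> Obj C"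
    and plus_obj: "X \<in> Obj C \<Longrightarrow> plus X \<in> Obj C"
    and incl_hom: "X \<in> Obj C \<Longrightarrow> incl X \<in> Hom C X (plus X)"
    and pt_hom: "X \<in> Obj C \<Longrightarrow> pt X \<in> Hom C A (plus X)"
    and copair_hom: "\<lbrakk>X \<in> Obj C; Z \<in> Obj C; f \<in> Hom C X Z; p \<in> Hom C A Z\<rbrakk>
        \<Longrightarrow> copair X Z f p \<in> Hom C (plus X) Z"
    and copair_incl: "\<lbrakk>X \<in> Obj C; Z \<in> Obj C; f \<in> Hom C X Z; p \<in> Hom C A Z\<rbrakk>
        \<Longrightarrow> Compose C X (plus X) Z (copair X Z f p) (incl X) = f"
    and copair_pt: "\<lbrakk>X \<in> Obj C; Z \<in> Obj C; f \<in> Hom C X Z; p \<in> Hom C A Z\<rbrakk>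
        \<Longrightarrow> Compose C A (plus X) Z (copair X Z f p) (pt X) = p"
    and plus_ext: "\<lbrakk>X \<in> Obj C; Z \<in> Obj C; g \<in> Hom C (plus X) Z; h \<in> Hom C (plus X) Z;
        Compose C X (plus X) Z g (incl X) = Compose C X (plus X) Z h (incl X);
        Compose C A (plus X) Z g (pt X) = Compose C A (plus X) Z h (pt X)\<rbrakk> \<Longrightarrow> g = h"
    and P_Obj: "Obj P = Obj C"
    and P_Hom: "Hom P X Y = Hom C X (plus Y)"
    and P_Ident: "Ident P X = incl X"
    and U_obj: "on_obj U X = plus X"
    and U_mor: "\<lbrakk>X \<in> Obj C; Y \<in> Obj C; f \<in> Hom C X (plus Y)\<rbrakk>
        \<Longrightarrow> on_mor U X Y f = copair X (plus Y) f (pt Y)"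
    and P_Compose: "\<lbrakk>X \<in> Obj C; Y \<in> Obj C; Z \<in> Obj C; f \<in> Hom C X (plus Y); g \<in> Hom C Y (plus Z)\<rbrakk>
        \<Longrightarrow> Compose P X Y Z g f = Compose C X (plus Y) (plus Z) (on_mor U Y Z g) f"
begin

lemma
  assumes "X \<in> Obj C" "Y \<in> Obj C" "f \<in> Hom C X (plus Y)"
  shows U_hom: "on_mor U X Y f \<in> Hom C (plus X) (plus Y)"
    and U_incl: "Compose C X (plus X) (plus Y) (on_mor U X Y f) (incl X) = f"
    and U_pt: "Compose C A (plus X) (plus Y) (on_mor U X Y f) (pt X) = pt Y"
  using assms by (auto simp: U_mor intro!: copair_hom copair_incl copair_pt plus_obj pt_hom)

lemma U_Ident: "X \<in> Obj C \<Longrightarrow> on_mor U X X (incl X) = Ident C (plus X)"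
  by (rule plus_ext[of X "plus X"])
    (auto simp: U_hom U_incl U_pt plus_obj incl_hom pt_hom ident_hom ident_left A_obj)

text \<open>The Kleisli extension law: both sides are determined by their restrictions along \<open>incl X\<close> and
  \<open>pt X\<close>.\<close>

lemma U_extension:
  assumes "X \<in> Obj C" "Y \<in> Obj C" "Z \<in> Obj C" "f \<in> Hom C X (plus Y)" "g \<in> Hom C Y (plus Z)"
  shows "on_mor U X Z (Compose C X (plus Y) (plus Z) (on_mor U Y Z g) f) =
    Compose C (plus X) (plus Y) (plus Z) (on_mor U Y Z g) (on_mor U X Y f)"
proof (rule plus_ext[of X "plus Z"])
  let ?g = "on_mor U Y Z g" and ?f = "on_mor U X Y f"
  have o: "plus X \<in> Obj C" "plus Y \<in> Obj C" "plus Z \<in> Obj C"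
    and g: "?g \<in> Hom C (plus Y) (plus Z)" and f: "?f \<in> Hom C (plus X) (plus Y)"
    using assms by (auto intro: plus_obj U_hom)
  have gf: "Compose C X (plus Y) (plus Z) ?g f \<in> Hom C X (plus Z)"
    using assms o g by (intro compose_hom)
  show "X \<in> Obj C" "plus Z \<in> Obj C" using assms o by auto
  show "on_mor U X Z (Compose C X (plus Y) (plus Z) ?g f) \<in> Hom C (plus X) (plus Z)"
    using assms gf by (intro U_hom)
  show "Compose C (plus X) (plus Y) (plus Z) ?g ?f \<in> Hom C (plus X) (plus Z)"
    using o f g by (intro compose_hom)
  show "Compose C X (plus X) (plus Z) (on_mor U X Z (Compose C X (plus Y) (plus Z) ?g f)) (incl X) =
      Compose C X (plus X) (plus Z) (Compose C (plus X) (plus Y) (plus Z) ?g ?f) (incl X)"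
    using compose_assoc[OF assms(1) o incl_hom[OF assms(1)] f g] U_incl[OF assms(1,3) gf] U_incl[OF assms(1,2,4)]
    by simp
  show "Compose C A (plus X) (plus Z) (on_mor U X Z (Compose C X (plus Y) (plus Z) ?g f)) (pt X) =
      Compose C A (plus X) (plus Z) (Compose C (plus X) (plus Y) (plus Z) ?g ?f) (pt X)"
    using compose_assoc[OF A_obj o pt_hom[OF assms(1)] f g] U_pt[OF assms(1,3) gf] U_pt[OF assms(1,2,4)]
      U_pt[OF assms(2,3,5)]
    by simp
qed

lemma category_P: "category P"
proof
  fix X Y Z f g
  assume "X \<in> Obj P" "Y \<in> Obj P" "Z \<in> Obj P" "f \<in> Hom P X Y" "g \<in> Hom P Y Z"
  then show "Compose P X Y Z g f \<in> Hom P X Z"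
    by (auto simp: P_Obj P_Hom P_Compose intro!: compose_hom U_hom plus_obj)
next
  fix W X Y Z f g h
  assume as: "W \<in> Obj P" "X \<in> Obj P" "Y \<in> Obj P" "Z \<in> Obj P"
    "f \<in> Hom P W X" "g \<in> Hom P X Y" "h \<in> Hom P Y Z"
  then have "Compose P X Y Z h g \<in> Hom C X (plus Z)" "Compose P W X Y g f \<in> Hom C W (plus Y)"
    by (auto simp: P_Obj P_Hom P_Compose intro!: compose_hom U_hom plus_obj)
  with as show "Compose P W Y Z h (Compose P W X Y g f) = Compose P W X Z (Compose P X Y Z h g) f"
    by (simp add: P_Obj P_Hom P_Compose U_extension compose_assoc U_hom plus_obj)
qed (simp_all add: P_Obj P_Hom P_Ident P_Compose U_Ident U_incl incl_hom ident_left plus_obj)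

lemma functor_U: "is_functor P C U"
  by (rule is_functor.intro)
    (simp_all add: category_P category_axioms P_Obj P_Hom P_Ident U_obj
      plus_obj U_hom U_Ident U_extension P_Compose)

text \<open>A morphism out of \<open>plus X\<close> that preserves the base point carries no information besides its
  restriction to \<open>X\<close>, so \<open>P\<close> is the full subcategory of the coslice on the free pointed objects.\<close>

lemma coslice_full:
  assumes o: "X \<in> Obj C" "Y \<in> Obj C" and h: "h \<in> Hom (coslice C A) (plus X, pt X) (plus Y, pt Y)"
  shows "\<exists>f\<in>Hom P X Y. on_mor U X Y f = h"
proof -
  have h: "h \<in> Hom C (plus X) (plus Y)" "Compose C A (plus X) (plus Y) h (pt X) = pt Y"
    using h by (auto simp: coslice_def)
  let ?f = "Compose C X (plus X) (plus Y) h (incl X)"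
  have f: "?f \<in> Hom C X (plus Y)"
    using o h by (intro compose_hom plus_obj incl_hom)
  then have "on_mor U X Y ?f = h"
    using plus_ext[of X "plus Y" "on_mor U X Y ?f" h] o h
    by (simp add: U_hom U_incl U_pt plus_obj)
  with f show ?thesis
    by (auto simp: P_Hom)
qed

lemma U_faithful:
  "\<lbrakk>X \<in> Obj P; Y \<in> Obj P; f \<in> Hom P X Y; f' \<in> Hom P X Y; on_mor U X Y f = on_mor U X Y f'\<rbrakk> \<Longrightarrow> f = f'"
  unfolding P_Obj P_Hom by (metis U_incl)

definition free :: "('o, 'm, 'o, 'm) funct" where
  "free = \<lparr>on_obj = (\<lambda>X. X), on_mor = (\<lambda>X Y f. Compose C X Y (plus Y) (incl Y) f)\<rparr>"

lemma free_simps: "on_obj free X = X" "on_mor free X Y f = Compose C X Y (plus Y) (incl Y) f"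
  by (simp_all add: free_def)

lemma free_hom:
  "\<lbrakk>X \<in> Obj C; Y \<in> Obj C; f \<in> Hom C X Y\<rbrakk> \<Longrightarrow> Compose C X Y (plus Y) (incl Y) f \<in> Hom C X (plus Y)"
  by (intro compose_hom incl_hom plus_obj)

lemma functor_free: "is_functor C P free"
proof (rule is_functor.intro)
  fix X Y Z f g
  assume as: "X \<in> Obj C" "Y \<in> Obj C" "Z \<in> Obj C" "f \<in> Hom C X Y" "g \<in> Hom C Y Z"
  let ?g = "Compose C Y Z (plus Z) (incl Z) g"
  note if' = free_hom[OF as(1,2,4)] and ig = free_hom[OF as(2,3,5)]
  have "Compose P X Y Z ?g (Compose C X Y (plus Y) (incl Y) f) =
      Compose C X (plus Y) (plus Z) (on_mor U Y Z ?g) (Compose C X Y (plus Y) (incl Y) f)"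
    by (rule P_Compose[OF as(1-3) if' ig])
  also have "\<dots> = Compose C X Y (plus Z) ?g f"
    using compose_assoc[OF as(1,2) plus_obj plus_obj as(4) incl_hom U_hom[OF as(2,3) ig]] U_incl[OF as(2,3) ig] as
    by simp
  also have "\<dots> = Compose C X Z (plus Z) (incl Z) (Compose C X Y Z g f)"
    using compose_assoc[OF as(1-3) plus_obj[OF as(3)] as(4,5) incl_hom[OF as(3)]] by simp
  finally show "on_mor free X Z (Compose C X Y Z g f) =
      Compose P (on_obj free X) (on_obj free Y) (on_obj free Z) (on_mor free Y Z g) (on_mor free X Y f)"
    by (simp add: free_simps)
qed (simp_all add: category_P category_axioms P_Obj P_Hom P_Ident free_simps free_hom ident_right incl_hom plus_obj)

text \<open>The identity of \<open>plus Y\<close> is the counit when it is read as a Kleisli morphism from \<open>plus Y\<close> to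
  \<open>Y\<close>.  Composing it with a free morphism cancels the inclusion, which gives naturality and both
  triangle identities.\<close>

lemma adjunction_free: "is_adjunction C P free U incl (\<lambda>Y. Ident C (plus Y))"
proof -
  note functors = functor_free functor_U functor_id[OF category_axioms] functor_id[OF category_P]
    functor_comp[OF functor_free functor_U] functor_comp[OF functor_U functor_free]
  note id_hom = ident_hom[OF plus_obj]
  have counit_comp: "Compose C W (plus (plus Y)) (plus Y) (on_mor U (plus Y) Y (Ident C (plus Y)))
      (Compose C W (plus Y) (plus (plus Y)) (incl (plus Y)) f) = f"
    if "W \<in> Obj C" "Y \<in> Obj C" "f \<in> Hom C W (plus Y)" for W Y f
    using that by (simp add: compose_assoc plus_obj incl_hom U_hom U_incl id_hom ident_left)
  show ?thesis
    unfolding is_adjunction_def is_nat_trans_def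
    using functors
    by (simp add: id_funct_def comp_funct_def free_simps U_obj P_Obj P_Hom P_Ident plus_obj incl_hom
        id_hom U_incl free_hom counit_comp U_hom U_hom[OF _ _ id_hom] P_Compose ident_right)
qed

text \<open>The image of the counit under \<open>U\<close> is the structure map of the free algebra on \<open>Y\<close>.  Its restriction
  along \<open>pt\<close> is the point under which this algebra corresponds to the object \<open>(plus Y, pt Y)\<close> of the
  coslice.\<close>

lemma counit_algebra:
  fixes Y defines "a \<equiv> on_mor U (plus Y) Y (Ident C (plus Y))"
  assumes "Y \<in> Obj C"
  shows "a \<in> Hom C (plus (plus Y)) (plus Y)"
    and "Compose C (plus Y) (plus (plus Y)) (plus Y) a (incl (plus Y)) = Ident C (plus Y)"
    and "Compose C A (plus (plus Y)) (plus Y) a (pt (plus Y)) = pt Y"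
  using assms by (auto simp: a_def U_hom U_incl U_pt plus_obj ident_hom)

abbreviation maybe :: "('o, 'm, 'o, 'm) funct" where
  "maybe \<equiv> comp_funct U free"

abbreviation algebras :: "('o \<times> 'm, 'm) cat" where
  "algebras \<equiv> eilenberg_moore C maybe incl (induced_mult free U (\<lambda>Y. Ident C (plus Y)))"

lemma maybe_simps:
  "on_obj maybe X = plus X"
  "on_mor maybe X Y f = on_mor U X Y (Compose C X Y (plus Y) (incl Y) f)"
  by (simp_all add: comp_funct_def free_simps U_obj)

text \<open>An algebra of the maybe monad is a pointed object: the unit law fixes the restriction of the
  structure map along \<open>incl\<close>, and its restriction along \<open>pt\<close> is the point.  Likewise the condition on
  an algebra homomorphism is automatic along \<open>incl\<close>, and along \<open>pt\<close> it says that points are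
  preserved.\<close>

lemma algebra_morphism_iff:
  assumes o: "X \<in> Obj C" "Y \<in> Obj C" and f: "f \<in> Hom C X Y"
    and a: "a \<in> Hom C (plus X) X" "Compose C X (plus X) X a (incl X) = Ident C X"
    and b: "b \<in> Hom C (plus Y) Y" "Compose C Y (plus Y) Y b (incl Y) = Ident C Y"
  shows "Compose C (plus X) X Y f a = Compose C (plus X) (plus Y) Y b (on_mor maybe X Y f) \<longleftrightarrow>
    Compose C A X Y f (Compose C A (plus X) X a (pt X)) = Compose C A (plus Y) Y b (pt Y)"
    (is "?l = ?r \<longleftrightarrow> _")
proof -
  note [simp] = o f a b plus_obj incl_hom pt_hom A_obj free_hom U_hom maybe_simps
  have hom: "?l \<in> Hom C (plus X) Y" "?r \<in> Hom C (plus X) Y"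
    by (auto intro!: compose_hom)
  have i: "Compose C X (plus X) Y ?l (incl X) = Compose C X (plus X) Y ?r (incl X)"
    by (simp add: compose_assoc[symmetric] U_incl ident_right) (simp add: compose_assoc ident_left)
  have p: "Compose C A (plus X) Y ?l (pt X) = Compose C A X Y f (Compose C A (plus X) X a (pt X))"
    "Compose C A (plus X) Y ?r (pt X) = Compose C A (plus Y) Y b (pt Y)"
    by (simp_all add: compose_assoc[symmetric] U_pt)
  show ?thesis
    using plus_ext[OF o hom i] p by metis
qed

end

text \<open>Every point of an object splits off as a coproduct summand.  This turns the fully faithful
  functors from the Kleisli category to the coslice and to the algebras into equivalences.\<close>

locale maybe_coproduct_complements = maybe_coproduct +
  assumes complement: "\<lbrakk>X \<in> Obj C; p \<in> Hom C A X\<rbrakk> \<Longrightarrow>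
    \<exists>Y\<in>Obj C. \<exists>f. is_iso C (plus Y) X f \<and> Compose C A (plus Y) X f (pt Y) = p"
begin

text \<open>The inverse of a point-preserving isomorphism preserves points as well; this is what makes it an
  isomorphism of pointed objects and of algebras.\<close>

lemma complement_iso:
  assumes "X \<in> Obj C" "p \<in> Hom C A X"
  shows "\<exists>Y\<in>Obj C. \<exists>f\<in>Hom C (plus Y) X. \<exists>g\<in>Hom C X (plus Y).
    Compose C (plus Y) X (plus Y) g f = Ident C (plus Y) \<and> Compose C X (plus Y) X f g = Ident C X \<and>
    Compose C A (plus Y) X f (pt Y) = p \<and> Compose C A X (plus Y) g p = pt Y"
proof -
  obtain Y f g where Y: "Y \<in> Obj C" and f: "f \<in> Hom C (plus Y) X" "g \<in> Hom C X (plus Y)"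
    "Compose C (plus Y) X (plus Y) g f = Ident C (plus Y)" "Compose C X (plus Y) X f g = Ident C X"
    "Compose C A (plus Y) X f (pt Y) = p"
    using complement[OF assms] unfolding is_iso_def by blast
  moreover have "Compose C A X (plus Y) g p = pt Y"
    using assms f Y
    by (auto simp: compose_assoc A_obj plus_obj pt_hom ident_left)
  ultimately show ?thesis by blast
qed

lemma equivalence_coslice:
  "is_equivalence P (coslice C A) \<lparr>on_obj = (\<lambda>X. (plus X, pt X)), on_mor = on_mor U\<rparr>"
    (is "is_equivalence _ _ ?K")
proof (rule equivalence_of_full_faithful_dense)
  show "is_functor P (coslice C A) ?K"
    by (simp add: is_functor_def category_coslice category_P category_axioms A_obj)
      (simp add: coslice_def P_Obj P_Hom P_Ident plus_obj pt_hom U_hom U_pt U_Ident P_Compose U_extension)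
next
  fix B assume "B \<in> Obj (coslice C A)"
  then obtain X p where B: "B = (X, p)" "X \<in> Obj C" "p \<in> Hom C A X"
    by (auto simp: coslice_def)
  with complement_iso[of X p] show "\<exists>X\<in>Obj P. \<exists>e. is_iso (coslice C A) (on_obj ?K X) B e"
    by (fastforce simp: P_Obj is_iso_def coslice_def)
qed (auto simp: P_Obj intro: coslice_full U_faithful)

lemma monadic_U: "monadic C P U"
proof -
  let ?\<epsilon> = "\<lambda>Y. Ident C (plus Y)"
  let ?K = "comparison free U ?\<epsilon>"
  let ?a = "\<lambda>Y. on_mor U (plus Y) Y (?\<epsilon> Y)"
  have K_obj: "on_obj ?K Y = (plus Y, ?a Y)" for Y
    by (simp add: comparison_def free_simps U_obj)
  have "is_equivalence P algebras ?K"
  proof (rule equivalence_of_full_faithful_dense)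
    show K: "is_functor P algebras ?K"
      by (rule functor_comparison[OF adjunction_free])
    \<comment> \<open>Homomorphisms between free algebras are the point-preserving morphisms, so fullness and
      faithfulness are those of the functor to the coslice.\<close>
    have K_hom: "Hom algebras (on_obj ?K X) (on_obj ?K Y) = Hom (coslice C A) (plus X, pt X) (plus Y, pt Y)"
      if "X \<in> Obj C" "Y \<in> Obj C" for X Y
      using that algebra_morphism_iff[OF plus_obj plus_obj _ counit_algebra(1,2) counit_algebra(1,2), of X Y]
      by (auto simp: K_obj eilenberg_moore_def coslice_def maybe_simps counit_algebra(3))
    {
      fix X Y h
      assume o: "X \<in> Obj P" "Y \<in> Obj P" and h: "h \<in> Hom algebras (on_obj ?K X) (on_obj ?K Y)"
      with K_hom[of X Y] show "\<exists>f\<in>Hom P X Y. on_mor ?K X Y f = h"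
        using coslice_full[of X Y h] by (auto simp: P_Obj comparison_def)
    next
      fix X Y f f'
      assume "X \<in> Obj P" "Y \<in> Obj P" "f \<in> Hom P X Y" "f' \<in> Hom P X Y" "on_mor ?K X Y f = on_mor ?K X Y f'"
      then show "f = f'"
        using U_faithful[of X Y f f'] by (simp add: comparison_def)
    next
      fix B assume "B \<in> Obj algebras"
      then obtain X b where B: "B = (X, b)" "X \<in> Obj C" "b \<in> Hom C (plus X) X"
        "Compose C X (plus X) X b (incl X) = Ident C X"
        by (auto simp: eilenberg_moore_def maybe_simps)
      have "Compose C A (plus X) X b (pt X) \<in> Hom C A X"
        using B by (intro compose_hom A_obj plus_obj pt_hom)
      then obtain Y f g where Y: "Y \<in> Obj C" and f: "f \<in> Hom C (plus Y) X" "g \<in> Hom C X (plus Y)"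
        "Compose C (plus Y) X (plus Y) g f = Ident C (plus Y)" "Compose C X (plus Y) X f g = Ident C X"
        "Compose C A (plus Y) X f (pt Y) = Compose C A (plus X) X b (pt X)"
        "Compose C A X (plus Y) g (Compose C A (plus X) X b (pt X)) = pt Y"
        using complement_iso[OF B(2)] by blast
      have "f \<in> Hom algebras (on_obj ?K Y) B" "g \<in> Hom algebras B (on_obj ?K Y)"
        using B Y f
          algebra_morphism_iff[OF plus_obj _ _ counit_algebra(1,2) B(3,4), of Y f]
          algebra_morphism_iff[OF _ plus_obj _ B(3,4) counit_algebra(1,2), of Y g]
        by (auto simp: K_obj eilenberg_moore_def maybe_simps counit_algebra(3))
      then have "is_iso algebras (on_obj ?K Y) B f"
        using f by (auto simp: is_iso_def K_obj B(1) eilenberg_moore_def intro!: bexI[of _ g])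
      with Y show "\<exists>X\<in>Obj P. \<exists>e. is_iso algebras (on_obj ?K X) B e"
        by (auto simp: P_Obj)
    }
  qed
  with adjunction_free show ?thesis
    unfolding monadic_def by blast
qed

end

section \<open>Quantale arithmetic and adjoint matrices\<close>

lemma mult_SUP: "(p::'q::comm_quantale) * (SUP i\<in>I. f i) = (SUP i\<in>I. p * f i)"
  by (simp add: mult_Sup image_image)

lemma SUP_mult: "(SUP i\<in>I. f i) * (p::'q::comm_quantale) = (SUP i\<in>I. f i * p)"
  using mult_SUP[of p f I] by (simp add: mult.commute)

lemma mult_bot [simp]: "(p::'q::comm_quantale) * bot = bot"
  using mult_Sup[of p "{}"] by simp

lemma bot_mult [simp]: "bot * (p::'q::comm_quantale) = bot"
  using mult_bot[of p] by (simp only: mult.commute)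

lemma mult_sup: "(p::'q::comm_quantale) * sup a b = sup (p * a) (p * b)"
  using mult_Sup[of p "{a, b}"] by simp

lemma quantale_mult_left_mono: "a \<le> b \<Longrightarrow> (p::'q::comm_quantale) * a \<le> p * b"
  using mult_sup[of p a b] by (simp add: sup_absorb2 le_iff_sup)

lemma quantale_mult_mono: "\<lbrakk>a \<le> b; c \<le> d\<rbrakk> \<Longrightarrow> (a::'q::comm_quantale) * c \<le> b * d"
  by (metis quantale_mult_left_mono mult.commute order_trans)

definition kron :: "'a \<Rightarrow> 'a \<Rightarrow> 'q::comm_quantale" where
  "kron x y = (if x = y then 1 else bot)"

lemma qid_alt: "qid X = (\<lambda>(x, y)\<in>X \<times> X. kron x y)"
  by (simp add: qid_def kron_def)

lemma SUP_kron: "x \<in> X \<Longrightarrow> (SUP y\<in>X. f y * kron x y) = (f x :: 'q::comm_quantale)"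
  "x \<in> X \<Longrightarrow> (SUP y\<in>X. f y * kron y x) = f x"
  by (auto intro!: antisym SUP_least SUP_upper2[of x] simp: kron_def)

text \<open>Left adjointness of \<open>f\<close> to \<open>g\<close> can be tested on each row \<open>x\<close> separately: the unit law is only a
  condition on the diagonal, and the counit law bounds a supremum over \<open>x\<close>.  A \<open>Q\<close>-map out of \<open>X\<close> is therefore
  nothing but an \<open>X\<close>-indexed family of \<open>Q\<close>-maps out of a point.\<close>

definition adjoint_rels :: "'a set \<Rightarrow> 'b set \<Rightarrow> ('a \<Rightarrow> 'b \<Rightarrow> 'q::comm_quantale) \<Rightarrow> ('b \<Rightarrow> 'a \<Rightarrow> 'q) \<Rightarrow> bool" where
  "adjoint_rels X Y f g \<longleftrightarrow>
    (\<forall>x\<in>X. 1 \<le> (SUP y\<in>Y. g y x * f x y) \<and> (\<forall>y\<in>Y. \<forall>y'\<in>Y. f x y' * g y x \<le> kron y y'))"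

lemma adjoint_unit: "\<lbrakk>adjoint_rels X Y f g; x \<in> X\<rbrakk> \<Longrightarrow> 1 \<le> (SUP y\<in>Y. g y x * f x y)"
  by (simp add: adjoint_rels_def)

lemma adjoint_counit:
  "\<lbrakk>adjoint_rels X Y f g; x \<in> X; y \<in> Y; y' \<in> Y\<rbrakk> \<Longrightarrow> f x y' * g y x \<le> kron y y'"
  by (simp add: adjoint_rels_def)

lemma qmap_iff:
  "\<zeta> \<in> qmap X Y \<longleftrightarrow> \<zeta> \<in> qrel X Y \<and> (\<exists>g. adjoint_rels X Y (curry \<zeta>) g)"
proof
  assume "\<zeta> \<in> qmap X Y"
  then obtain \<eta> where z: "\<zeta> \<in> qrel X Y" and le: "qid X \<le> qcomp X Y X \<eta> \<zeta>" "qcomp Y X Y \<zeta> \<eta> \<le> qid Y"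
    by (auto simp: qmap_def)
  have "adjoint_rels X Y (curry \<zeta>) (curry \<eta>)"
    unfolding adjoint_rels_def
  proof (intro ballI conjI)
    fix x assume x: "x \<in> X"
    then show "1 \<le> (SUP y\<in>Y. curry \<eta> y x * curry \<zeta> x y)"
      using le(1)[THEN le_funD, of "(x, x)"] by (simp add: qid_def qcomp_def)
    fix y y' assume y: "y \<in> Y" "y' \<in> Y"
    have "\<zeta> (x, y') * \<eta> (y, x) \<le> (SUP x\<in>X. \<zeta> (x, y') * \<eta> (y, x))"
      using x by (rule SUP_upper)
    also have "\<dots> \<le> kron y y'"
      using y le(2)[THEN le_funD, of "(y, y')"] by (simp add: qid_def qcomp_def kron_def)
    finally show "curry \<zeta> x y' * curry \<eta> y x \<le> kron y y'" by simp
  qed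
  with z show "\<zeta> \<in> qrel X Y \<and> (\<exists>g. adjoint_rels X Y (curry \<zeta>) g)" by blast
next
  assume "\<zeta> \<in> qrel X Y \<and> (\<exists>g. adjoint_rels X Y (curry \<zeta>) g)"
  then obtain g where z: "\<zeta> \<in> qrel X Y" and adj: "adjoint_rels X Y (curry \<zeta>) g" by blast
  let ?\<eta> = "\<lambda>(y, x)\<in>Y \<times> X. g y x"
  have "qid X \<le> qcomp X Y X ?\<eta> \<zeta>"
    using adjoint_unit[OF adj] by (auto simp: qid_def qcomp_def le_fun_def)
  moreover have "qcomp Y X Y \<zeta> ?\<eta> \<le> qid Y"
    using adjoint_counit[OF adj] by (auto simp: qid_alt qcomp_def le_fun_def intro!: SUP_least)
  moreover have "?\<eta> \<in> qrel Y X" by (simp add: qrel_def)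
  ultimately show "\<zeta> \<in> qmap X Y"
    using z by (auto simp: qmap_def)
qed

lemma qmapI:
  assumes "adjoint_rels X Y f g"
  shows "(\<lambda>(x, y)\<in>X \<times> Y. f x y) \<in> qmap X Y"
proof -
  have "adjoint_rels X Y (curry (\<lambda>(x, y)\<in>X \<times> Y. f x y)) g"
    using assms by (simp add: adjoint_rels_def)
  then show ?thesis by (auto simp: qmap_iff qrel_def)
qed

lemma qmapE:
  assumes "\<zeta> \<in> qmap X Y"
  obtains f g where "\<zeta> = (\<lambda>(x, y)\<in>X \<times> Y. f x y)" "adjoint_rels X Y f g"
proof -
  from assms obtain g where z: "\<zeta> \<in> qrel X Y" and g: "adjoint_rels X Y (curry \<zeta>) g" by (auto simp: qmap_iff)
  have "\<zeta> = (\<lambda>(x, y)\<in>X \<times> Y. curry \<zeta> x y)"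
    using z by (auto simp: qrel_def fun_eq_iff restrict_def PiE_def extensional_def)
  with g that show thesis by blast
qed

lemma qmap_ext:
  assumes "\<zeta> \<in> qmap X Y" "\<xi> \<in> qmap X Y" "\<And>x y. \<lbrakk>x \<in> X; y \<in> Y\<rbrakk> \<Longrightarrow> \<zeta> (x, y) = \<xi> (x, y)"
  shows "\<zeta> = \<xi>"
  using assms by (auto simp: qmap_def qrel_def intro: PiE_ext)

lemma adjoint_kron:
  assumes "\<And>x. x \<in> X \<Longrightarrow> h x \<in> Y"
  shows "adjoint_rels X Y (\<lambda>x. kron (h x)) (\<lambda>y x. kron (h x) y)"
  unfolding adjoint_rels_def
  using assms by (auto simp: SUP_kron) (auto simp: kron_def)

text \<open>For the unit, the terms of \<open>(SUP y) (SUP y')\<close> with \<open>y = y'\<close> already suffice; for the counit, the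
  terms with \<open>y \<noteq> y'\<close> vanish because the counit of the first adjunction is \<open>bot\<close> off the diagonal.\<close>

lemma adjoint_comp:
  assumes "adjoint_rels X Y f f'" and "adjoint_rels Y Z g g'"
  shows "adjoint_rels X Z (\<lambda>x z. SUP y\<in>Y. g y z * f x y) (\<lambda>z x. SUP y\<in>Y. f' y x * g' z y)"
  unfolding adjoint_rels_def
proof (intro ballI conjI)
  fix x assume x: "x \<in> X"
  have "1 \<le> (SUP y\<in>Y. f' y x * f x y)"
    using assms x by (auto simp: adjoint_rels_def)
  also have "\<dots> \<le> (SUP y\<in>Y. (f' y x * f x y) * (SUP z\<in>Z. g' z y * g y z))"
  proof (rule SUP_mono)
    fix y assume "y \<in> Y"
    with quantale_mult_left_mono[of 1 "SUP z\<in>Z. g' z y * g y z" "f' y x * f x y"] assms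
    show "\<exists>m\<in>Y. f' y x * f x y \<le> f' m x * f x m * (SUP z\<in>Z. g' z m * g m z)"
      by (auto simp: adjoint_rels_def)
  qed
  also have "\<dots> \<le> (SUP z\<in>Z. (SUP y\<in>Y. f' y x * g' z y) * (SUP y\<in>Y. g y z * f x y))"
    unfolding mult_SUP
  proof (intro SUP_least)
    fix y z assume yz: "y \<in> Y" "z \<in> Z"
    have "f' y x * f x y * (g' z y * g y z) = (f' y x * g' z y) * (g y z * f x y)"
      by (simp add: ac_simps)
    also have "\<dots> \<le> (SUP y\<in>Y. f' y x * g' z y) * (SUP y\<in>Y. g y z * f x y)"
      using yz by (intro quantale_mult_mono SUP_upper)
    also have "\<dots> = (SUP y\<in>Y. (SUP y\<in>Y. f' y x * g' z y) * (g y z * f x y))"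
      by (simp add: mult_SUP)
    finally show "f' y x * f x y * (g' z y * g y z) \<le> (SUP z\<in>Z. SUP y\<in>Y. (SUP y\<in>Y. f' y x * g' z y) * (g y z * f x y))"
      using yz(2) by (rule SUP_upper2[rotated])
  qed
  finally show "1 \<le> (SUP z\<in>Z. (SUP y\<in>Y. f' y x * g' z y) * (SUP y\<in>Y. g y z * f x y))" .
next
  fix x z z' assume x: "x \<in> X" and z: "z \<in> Z" "z' \<in> Z"
  show "(SUP y\<in>Y. g y z' * f x y) * (SUP y\<in>Y. f' y x * g' z y) \<le> kron z z'"
    unfolding SUP_mult mult_SUP
  proof (intro SUP_least)
    fix y y' assume y: "y \<in> Y" "y' \<in> Y"
    have "g y z' * f x y * (f' y' x * g' z y') = (f x y * f' y' x) * (g y z' * g' z y')"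
      by (simp add: ac_simps)
    also have "\<dots> \<le> kron y' y * (g y z' * g' z y')"
      using assms(1) x y by (intro quantale_mult_mono) (auto simp: adjoint_rels_def)
    also have "\<dots> \<le> kron z z'"
      using adjoint_counit[OF assms(2) y(1) z] by (auto simp: kron_def[of y'])
    finally show "g y z' * f x y * (f' y' x * g' z y') \<le> kron z z'" .
  qed
qed

lemma qmap_comp:
  assumes "\<phi> \<in> qmap X Y" "\<psi> \<in> qmap Y Z"
  shows "qcomp X Y Z \<psi> \<phi> \<in> qmap X Z"
proof -
  from assms(1) obtain f f' where f: "\<phi> = (\<lambda>(x, y)\<in>X \<times> Y. f x y)" "adjoint_rels X Y f f'"
    by (rule qmapE)
  from assms(2) obtain g g' where g: "\<psi> = (\<lambda>(x, y)\<in>Y \<times> Z. g x y)" "adjoint_rels Y Z g g'"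
    by (rule qmapE)
  have "qcomp X Y Z \<psi> \<phi> = (\<lambda>(x, z)\<in>X \<times> Z. SUP y\<in>Y. g y z * f x y)"
    by (auto simp: qcomp_def f g fun_eq_iff)
  with qmapI[OF adjoint_comp[OF f(2) g(2)]] show ?thesis by simp
qed

lemma category_QMap: "category (QMap \<U> :: ('u set, 'u \<times> 'u \<Rightarrow> 'q::comm_quantale) cat)"
proof -
  have id: "qid X \<in> qmap X X" for X :: "'u set"
    unfolding qid_alt using adjoint_kron[of X id X] by (intro qmapI) simp
  show ?thesis
  proof
    fix W X Y Z :: "'u set" and f g h :: "'u \<times> 'u \<Rightarrow> 'q"
    have "(SUP y\<in>Y. h (y, z) * (SUP x\<in>X. g (x, y) * f (w, x))) =
        (SUP x\<in>X. (SUP y\<in>Y. h (y, z) * g (x, y)) * f (w, x))" for w z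
      unfolding mult_SUP SUP_mult by (subst SUP_commute) (simp add: mult.assoc)
    then show "Compose (QMap \<U>) W Y Z h (Compose (QMap \<U>) W X Y g f) =
        Compose (QMap \<U>) W X Z (Compose (QMap \<U>) X Y Z h g) f"
      by (auto simp: QMap_def qcomp_def fun_eq_iff)
  next
    fix X Y :: "'u set" and f :: "'u \<times> 'u \<Rightarrow> 'q"
    assume "f \<in> Hom (QMap \<U>) X Y"
    then have f: "f \<in> qmap X Y" by (simp add: QMap_def)
    show "Compose (QMap \<U>) X X Y f (Ident (QMap \<U>) X) = f"
      using f qmap_comp[OF id f] by (auto intro!: qmap_ext simp: QMap_def) (auto simp: qcomp_def qid_alt SUP_kron)
    show "Compose (QMap \<U>) X Y Y (Ident (QMap \<U>) Y) f = f"
      using f qmap_comp[OF f id]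
      by (auto intro!: qmap_ext simp: QMap_def) (auto simp: qcomp_def qid_alt SUP_kron mult.commute[of "kron _ _"])
  qed (auto simp: QMap_def id qmap_comp)
qed

text \<open>The unit of one adjunction and the counit of the other are opposite inequalities for the same
  composite.\<close>

lemma adjoint_both_ways_inverse:
  assumes "adjoint_rels X Y f g" "adjoint_rels Y X g f"
  shows "qcomp X Y X (\<lambda>(y, x)\<in>Y \<times> X. g y x) (\<lambda>(x, y)\<in>X \<times> Y. f x y) = qid X"
proof -
  have "(SUP y\<in>Y. g y x' * f x y) = kron x x'" if x: "x \<in> X" "x' \<in> X" for x x'
  proof (rule antisym)
    show "(SUP y\<in>Y. g y x' * f x y) \<le> kron x x'"
      using assms(2) x by (auto simp: adjoint_rels_def intro: SUP_least)
    show "kron x x' \<le> (SUP y\<in>Y. g y x' * f x y)"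
      using assms(1) x by (auto simp: adjoint_rels_def kron_def)
  qed
  then show ?thesis by (auto simp: qcomp_def qid_alt fun_eq_iff)
qed

section \<open>Splitting off a point\<close>

text \<open>Given a point \<open>m\<close> of \<open>X\<close> with right adjoint \<open>l\<close>, the elements \<open>e x = l x * m x\<close> form a partition of
  the unit into orthogonal idempotents; think of \<open>e x\<close> as the region where the point \<open>m\<close> sits at \<open>x\<close>.
  The matrix is the automorphism of \<open>X\<close> that on the region \<open>e x\<close> transposes \<open>x0\<close> and \<open>x\<close>, up to the unit
  \<open>m x\<close> of that region.  It sends \<open>x0\<close> to \<open>m\<close>; an \<open>x \<noteq> x0\<close> goes to \<open>x0\<close> on \<open>e x\<close> and
  stays put on the complementary region, the supremum of the other \<open>e z\<close>.\<close>

definition point_match :: "'a \<Rightarrow> 'a set \<Rightarrow> ('a \<Rightarrow> 'q) \<Rightarrow> ('a \<Rightarrow> 'q) \<Rightarrow> 'a \<Rightarrow> 'a \<Rightarrow> 'q::comm_quantale" where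
  "point_match x0 X m l x y =
    (if x = x0 then m y
     else if y = x0 then l x * m x
     else if y = x then (SUP z\<in>X - {x}. l z * m z)
     else bot)"

text \<open>Each row and each column is, up to the invertible factors \<open>m\<close> and \<open>l\<close>, a partition of the unit: the
  \<open>e z\<close> for the row and column of \<open>x0\<close>, and \<open>e x\<close> with its complement \<open>n x\<close> for the others.  Orthogonality
  of the pieces gives the counits, their supremum being \<open>1\<close> gives the units.  The inverse matrix is
  the transpose with \<open>m\<close> and \<open>l\<close> exchanged, so that adjointness both ways makes it an isomorphism.\<close>

lemma adjoint_point_match:
  fixes m l :: "'a \<Rightarrow> 'q::comm_quantale"
  assumes x0: "x0 \<in> X"
    and total: "1 \<le> (SUP y\<in>X. l y * m y)"
    and orth: "\<And>y y'. \<lbrakk>y \<in> X; y' \<in> X\<rbrakk> \<Longrightarrow> m y' * l y \<le> kron y y'"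
  shows "adjoint_rels X X (point_match x0 X m l) (\<lambda>y x. point_match x0 X l m x y)"
    and "adjoint_rels X X (\<lambda>y x. point_match x0 X l m x y) (point_match x0 X m l)"
proof -
  define e where "e y = l y * m y" for y
  define n where "n x = (SUP z\<in>X - {x}. e z)" for x
  have e_le: "e y \<le> 1" if "y \<in> X" for y
    using orth[OF that that] by (simp add: e_def kron_def mult.commute)
  have ortho: "m y' * l y = bot" if "y \<in> X" "y' \<in> X" "y \<noteq> y'" for y y'
    using orth[OF that(1,2)] that(3) by (simp add: kron_def bot_unique)
  have ee: "e x * e z = bot" if "x \<in> X" "z \<in> X" "x \<noteq> z" for x z
  proof -
    have "e x * e z = (l x * m z) * (m x * l z)" by (simp add: e_def ac_simps)
    then show ?thesis using ortho[of z x] that by simp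
  qed
  \<comment> \<open>The complement of \<open>e x\<close> in the partition of the unit is \<open>n x\<close>.\<close>
  have one: "sup (e x) (n x) = 1" if x: "x \<in> X" for x
  proof -
    have "(SUP y\<in>X. e y) = 1"
    proof (rule antisym)
      show "(SUP y\<in>X. e y) \<le> 1" by (rule SUP_least) (rule e_le)
      show "1 \<le> (SUP y\<in>X. e y)" using total by (simp add: e_def)
    qed
    moreover have "insert x (X - {x}) = X" using x by auto
    ultimately show ?thesis unfolding n_def by (metis SUP_insert)
  qed
  have n_le: "n x \<le> 1" if "x \<in> X" for x
    using one[OF that] by (metis sup.cobounded2)
  have en: "e x * n x = bot" if "x \<in> X" for x
    using that ee by (auto simp: n_def mult_SUP)
  have e_idem: "e x * e x = e x" if "x \<in> X" for x
    using arg_cong[OF one[OF that], of "\<lambda>q. e x * q"] by (simp add: mult_sup en[OF that])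
  have n_idem: "n x * n x = n x" if "x \<in> X" for x
    using arg_cong[OF one[OF that], of "\<lambda>q. n x * q"]
    by (simp add: mult_sup mult.commute[of "n x" "e x"] en[OF that])
  have pm: "point_match x0 X m l x y = (if x = x0 then m y else if y = x0 then e x else if y = x then n x else bot)"
    "point_match x0 X l m x y = (if x = x0 then l y else if y = x0 then e x else if y = x then n x else bot)" for x y
    by (simp_all add: point_match_def e_def n_def mult.commute)
  have me: "m y * e z = bot" and le: "l y * e z = bot" if "y \<in> X" "z \<in> X" "y \<noteq> z" for y z
  proof -
    have "m y * e z = (m y * l z) * m z" "l y * e z = (m z * l y) * l z"
      by (simp_all add: e_def ac_simps)
    then show "m y * e z = bot" "l y * e z = bot"
      using ortho[of z y] ortho[of y z] that by auto
  qed
  have mn: "m y * n y = bot" and ln: "l y * n y = bot" if y: "y \<in> X" for y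
  proof -
    have "m y * e z = bot" "l y * e z = bot" if "z \<in> X - {y}" for z
      using me[of y z] le[of y z] y that by auto
    then show "m y * n y = bot" "l y * n y = bot" by (simp_all add: n_def mult_SUP)
  qed
  show "adjoint_rels X X (\<lambda>y x. point_match x0 X l m x y) (point_match x0 X m l)"
    unfolding adjoint_rels_def
  proof (intro ballI conjI)
    fix y assume y: "y \<in> X"
    show "1 \<le> (SUP x\<in>X. point_match x0 X m l x y * point_match x0 X l m x y)"
    proof (cases "y = x0")
      case True
      have "point_match x0 X m l x y * point_match x0 X l m x y = e x" if "x \<in> X" for x
        using True e_idem[OF that] by (simp add: pm e_def mult.commute)
      then show ?thesis using total by (simp add: e_def cong: SUP_cong)
    next
      case False
      have "1 = sup (m y * l y) (n y * n y)" using one[OF y] by (simp add: e_def n_idem[OF y] mult.commute)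
      also have "\<dots> \<le> (SUP x\<in>X. point_match x0 X m l x y * point_match x0 X l m x y)"
        using y x0 False by (intro sup_least SUP_upper2[of x0] SUP_upper2[of y]) (simp_all add: pm)
      finally show ?thesis .
    qed
    fix x x' assume x: "x \<in> X" "x' \<in> X"
    have "point_match x0 X l m x y * point_match x0 X m l x y \<le> 1"
      using x y x0 e_le[of x] e_le[of x0] e_le[of y] n_le[of x] n_idem[of x] e_idem[of x]
      by (auto simp: pm e_def[symmetric])
    moreover have "point_match x0 X l m x' y * point_match x0 X m l x y = bot" if "x \<noteq> x'"
      using that x y x0 
      by (auto simp: pm ee mn ln me le mn[THEN trans[OF mult.commute]] ln[THEN trans[OF mult.commute]]
          me[THEN trans[OF mult.commute]] le[THEN trans[OF mult.commute]])
    ultimately show "point_match x0 X l m x' y * point_match x0 X m l x y \<le> kron x x'"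
      by (auto simp: kron_def)
  qed
  show "adjoint_rels X X (point_match x0 X m l) (\<lambda>y x. point_match x0 X l m x y)"
    unfolding adjoint_rels_def
  proof (intro ballI conjI)
    fix x assume x: "x \<in> X"
    show "1 \<le> (SUP y\<in>X. point_match x0 X l m x y * point_match x0 X m l x y)"
    proof (cases "x = x0")
      case True
      then show ?thesis using total by (simp add: pm)
    next
      case False
      have "1 = sup (e x * e x) (n x * n x)" using one[OF x] by (simp add: e_idem[OF x] n_idem[OF x])
      also have "\<dots> \<le> (SUP y\<in>X. point_match x0 X l m x y * point_match x0 X m l x y)"
        using x x0 False by (intro sup_least SUP_upper2[of x0] SUP_upper2[of x]) (simp_all add: pm)
      finally show ?thesis .
    qed
    fix y y' assume "y \<in> X" "y' \<in> X"
    then show "point_match x0 X m l x y' * point_match x0 X l m x y \<le> kron y y'"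
      using x orth[of y y'] en[OF x] quantale_mult_mono[OF e_le e_le, of x x] quantale_mult_mono[OF n_le n_le, of x x]
      by (auto simp: pm kron_def mult.commute)
  qed
qed

text \<open>The complement of the point \<open>\<mu>\<close> is \<open>X - {x0}\<close> for an arbitrary \<open>x0\<close>: the set \<open>(X - {x0})\<^sub>+\<close> is in
  bijection with \<open>X\<close>, with the base point at \<open>x0\<close>, and \<open>point_match\<close> moves \<open>x0\<close> to \<open>\<mu>\<close>.  Such an \<open>x0\<close> exists
  because over a non-trivial quantale the empty set has no point.\<close>

lemma point_complement:
  fixes \<mu> :: "'u \<times> 'u \<Rightarrow> 'q::comm_quantale"
  assumes inl: "inj inl" "star \<notin> range inl" and nontrivial: "(bot :: 'q) < 1"
    and \<mu>: "\<mu> \<in> qmap {star} X"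
  shows "\<exists>Y\<subseteq>X. \<exists>\<tau>\<in>qmap (plus_pt inl star Y) X. \<exists>\<sigma>\<in>qmap X (plus_pt inl star Y).
    qcomp (plus_pt inl star Y) X (plus_pt inl star Y) \<sigma> \<tau> = qid (plus_pt inl star Y) \<and>
    qcomp X (plus_pt inl star Y) X \<tau> \<sigma> = qid X \<and>
    (\<forall>x\<in>X. \<tau> (star, x) = \<mu> (star, x))"
proof -
  obtain f g where \<mu>_eq: "\<mu> = (\<lambda>(s, x)\<in>{star} \<times> X. f s x)" and adj: "adjoint_rels {star} X f g"
    using \<mu> by (rule qmapE)
  define m l where "m = f star" and "l x = g x star" for x
  have total: "1 \<le> (SUP y\<in>X. l y * m y)"
    and orth: "\<And>y y'. \<lbrakk>y \<in> X; y' \<in> X\<rbrakk> \<Longrightarrow> m y' * l y \<le> kron y y'"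
    using adj by (auto simp: adjoint_rels_def m_def l_def)
  have "X \<noteq> {}" using total nontrivial by (auto simp: less_le_not_le)
  then obtain x0 where x0: "x0 \<in> X" by blast
  let ?Y = "X - {x0}"
  let ?V = "plus_pt inl star ?Y"
  define b where "b v = (if v = star then x0 else inv inl v)" for v
  have b_inl: "b (inl y) = y" for y
    using inl by (auto simp: b_def)
  have b: "bij_betw b ?V X"
    using inl x0 by (intro bij_betwI[where g = "\<lambda>x. if x = x0 then star else inl x"])
      (auto simp: plus_pt_def b_inl b_def[of star])
  let ?T = "point_match x0 X m l" and ?S = "\<lambda>y x. point_match x0 X l m x y"
  note match = adjoint_point_match[OF x0 total orth]
  have bX: "b v \<in> X" if "v \<in> ?V" for v using b that by (rule bij_betwE[rule_format])
  have T: "adjoint_rels ?V X (\<lambda>v. ?T (b v)) (\<lambda>x v. ?S x (b v))"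
    using match(1) bX by (auto simp: adjoint_rels_def)
  have SUP_b: "(SUP v\<in>?V. h (b v)) = (SUP y\<in>X. h y)" for h :: "'u \<Rightarrow> 'q"
    using bij_betw_imp_surj_on[OF b] by (metis image_image)
  have S: "adjoint_rels X ?V (\<lambda>x v. ?S x (b v)) (\<lambda>v. ?T (b v))"
    unfolding adjoint_rels_def
  proof (intro ballI conjI)
    fix x assume x: "x \<in> X"
    then show "1 \<le> (SUP v\<in>?V. ?T (b v) x * ?S x (b v))"
      using match(2) by (simp add: SUP_b[of "\<lambda>y. ?T y x * ?S x y"] adjoint_rels_def)
    fix v w assume vw: "v \<in> ?V" "w \<in> ?V"
    then have "kron (b v) (b w) = (kron v w :: 'q)"
      using bij_betw_imp_inj_on[OF b] by (auto simp: kron_def inj_on_def)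
    then show "?S x (b w) * ?T (b v) x \<le> kron v w"
      using match(2) x bX vw by (metis (no_types, lifting) adjoint_rels_def)
  qed
  let ?\<tau> = "\<lambda>(v, x)\<in>?V \<times> X. ?T (b v) x" and ?\<sigma> = "\<lambda>(x, v)\<in>X \<times> ?V. ?S x (b v)"
  have "?\<tau> (star, x) = \<mu> (star, x)" if "x \<in> X" for x
    using that by (simp add: \<mu>_eq plus_pt_def b_def point_match_def m_def)
  with qmapI[OF T] qmapI[OF S] adjoint_both_ways_inverse[OF T S] adjoint_both_ways_inverse[OF S T]
  show ?thesis by blast
qed

section \<open>The coproduct with a point in the category of sets and Q-maps\<close>

definition pt_incl :: "('u \<Rightarrow> 'u) \<Rightarrow> 'u \<Rightarrow> 'u set \<Rightarrow> 'u \<times> 'u \<Rightarrow> 'q::comm_quantale" where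
  "pt_incl inl star X = (\<lambda>(s, w)\<in>{star} \<times> plus_pt inl star X. kron star w)"

definition qcopair ::
  "('u \<Rightarrow> 'u) \<Rightarrow> 'u \<Rightarrow> 'u set \<Rightarrow> 'u set \<Rightarrow> ('u \<times> 'u \<Rightarrow> 'q) \<Rightarrow> ('u \<times> 'u \<Rightarrow> 'q) \<Rightarrow> 'u \<times> 'u \<Rightarrow> 'q::comm_quantale" where
  "qcopair inl star X Z f p = (\<lambda>(v, z)\<in>plus_pt inl star X \<times> Z.
    if v = star then p (star, z) else f (inv inl v, z))"

context
  fixes inl :: "'u \<Rightarrow> 'u" and star :: 'u
  assumes inl: "inj inl" "star \<notin> range inl"
begin

lemma inl_simps [simp]: "inl x \<noteq> star" "star \<noteq> inl x" "inv inl (inl x) = x"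
  "inl x = inl y \<longleftrightarrow> x = y" "star \<in> plus_pt inl star X" "inl x \<in> plus_pt inl star X \<longleftrightarrow> x \<in> X"
  using inl by (auto simp: plus_pt_def inj_eq)

lemma pid_qmap: "(pid inl star X :: 'u \<times> 'u \<Rightarrow> 'q::comm_quantale) \<in> qmap X (plus_pt inl star X)"
proof -
  have "(pid inl star X :: 'u \<times> 'u \<Rightarrow> 'q) = (\<lambda>(x, w)\<in>X \<times> plus_pt inl star X. kron (inl x) w)"
    by (auto simp: pid_def kron_def fun_eq_iff)
  moreover have "(\<lambda>(x, w)\<in>X \<times> plus_pt inl star X. kron (inl x) w :: 'q) \<in> qmap X (plus_pt inl star X)"
    by (rule qmapI[OF adjoint_kron]) simp
  ultimately show ?thesis by simp
qed

lemma pt_incl_qmap: "pt_incl inl star X \<in> qmap {star} (plus_pt inl star X)"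
  unfolding pt_incl_def by (rule qmapI[OF adjoint_kron]) simp

lemma qcopair_qmap:
  assumes "f \<in> qmap X Z" "p \<in> qmap {star} Z"
  shows "qcopair inl star X Z f p \<in> qmap (plus_pt inl star X) Z"
proof -
  obtain f1 g1 where f: "f = (\<lambda>(x, z)\<in>X \<times> Z. f1 x z)" "adjoint_rels X Z f1 g1"
    using assms(1) by (rule qmapE)
  obtain f2 g2 where p: "p = (\<lambda>(x, z)\<in>{star} \<times> Z. f2 x z)" "adjoint_rels {star} Z f2 g2"
    using assms(2) by (rule qmapE)
  let ?f = "\<lambda>v z. if v = star then f2 star z else f1 (inv inl v) z"
    and ?g = "\<lambda>z v. if v = star then g2 z star else g1 z (inv inl v)"
  have "adjoint_rels (plus_pt inl star X) Z ?f ?g"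
    using f(2) p(2) by (auto simp: adjoint_rels_def plus_pt_def)
  moreover have "qcopair inl star X Z f p = (\<lambda>(v, z)\<in>plus_pt inl star X \<times> Z. ?f v z)"
    by (auto simp: qcopair_def f p fun_eq_iff plus_pt_def)
  ultimately show ?thesis by (simp add: qmapI)
qed

lemma qcomp_pid:
  assumes "x \<in> X" "z \<in> Z"
  shows "qcomp X (plus_pt inl star X) Z g (pid inl star X) (x, z) = g (inl x, z)"
proof -
  have "qcomp X (plus_pt inl star X) Z g (pid inl star X) (x, z) =
      (SUP v\<in>plus_pt inl star X. g (v, z) * kron (inl x) v)"
    using assms by (auto simp: qcomp_def pid_def kron_def intro!: SUP_cong)
  also have "\<dots> = g (inl x, z)"
    using assms(1) by (intro SUP_kron) simp
  finally show ?thesis .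
qed

lemma qcomp_pt_incl:
  assumes "z \<in> Z"
  shows "qcomp {star} (plus_pt inl star X) Z g (pt_incl inl star X) (star, z) = g (star, z)"
  using assms by (simp add: qcomp_def pt_incl_def SUP_kron)

text \<open>Splitting the supremum over \<open>Y\<^sub>+\<close> into the terms from \<open>Y\<close> and the base point gives the explicit
  formula for the Kleisli composite: the base point contributes only to the entry at \<open>star\<close>.\<close>

lemma pcomp_eq_extension:
  fixes \<zeta> \<eta> :: "'u \<times> 'u \<Rightarrow> 'q::comm_quantale"
  assumes z: "\<zeta> \<in> qmap X (plus_pt inl star Y)" and e: "\<eta> \<in> qmap Y (plus_pt inl star Z)"
  shows "pcomp inl star X Y Z \<eta> \<zeta> =
    qcomp X (plus_pt inl star Y) (plus_pt inl star Z) (on_mor (U_T inl star) Y Z \<eta>) \<zeta>"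
proof -
  have "(SUP v\<in>plus_pt inl star Y. on_mor (U_T inl star) Y Z \<eta> (v, w) * \<zeta> (x, v)) =
      sup ((if w = star then 1 else bot) * \<zeta> (x, star)) (SUP y\<in>Y. \<eta> (y, w) * \<zeta> (x, inl y))"
    if w: "w \<in> plus_pt inl star Z" for x w
  proof -
    have "(SUP v\<in>plus_pt inl star Y. h v) = sup (h star) (SUP y\<in>Y. h (inl y))" for h :: "'u \<Rightarrow> 'q"
      by (simp add: plus_pt_def image_image)
    then show ?thesis using w by (simp add: U_T_def cong: SUP_cong)
  qed
  then show ?thesis
    by (auto simp: pcomp_def qcomp_def fun_eq_iff sup_commute)
qed

end

lemma maybe_coproduct_QMap:
  assumes universe: "set_universe \<U> inl star" and nontrivial: "(bot :: 'q::comm_quantale) < 1"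
  shows "maybe_coproduct_complements (QMap \<U> :: ('u set, 'u \<times> 'u \<Rightarrow> 'q) cat) {star}
    (plus_pt inl star) (pid inl star) (pt_incl inl star) (qcopair inl star)
    (PQMap \<U> inl star) (U_T inl star)"
proof -
  interpret set_universe \<U> inl star by (rule universe)
  note inl = inj_inl star_inl
  interpret Q: category "QMap \<U> :: ('u set, 'u \<times> 'u \<Rightarrow> 'q) cat" by (rule category_QMap)
  have copair_incl: "qcomp X (plus_pt inl star X) Z (qcopair inl star X Z f p) (pid inl star X) = f"
    and copair_pt: "qcomp {star} (plus_pt inl star X) Z (qcopair inl star X Z f p) (pt_incl inl star X) = p"
    if "f \<in> qmap X Z" "p \<in> qmap {star} Z" for X Z and f p :: "'u \<times> 'u \<Rightarrow> 'q"
    using that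
    by (auto intro!: qmap_ext qmap_comp pid_qmap[OF inl] pt_incl_qmap[OF inl] qcopair_qmap[OF inl]
        simp: qcomp_pid[OF inl] qcomp_pt_incl[OF inl])
      (auto simp: qcopair_def inl_simps[OF inl])
  have plus_ext: "g = h"
    if g: "g \<in> qmap (plus_pt inl star X) Z" and h: "h \<in> qmap (plus_pt inl star X) Z"
      and eq: "qcomp X (plus_pt inl star X) Z g (pid inl star X) = qcomp X (plus_pt inl star X) Z h (pid inl star X)"
        "qcomp {star} (plus_pt inl star X) Z g (pt_incl inl star X) =
          qcomp {star} (plus_pt inl star X) Z h (pt_incl inl star X)"
    for X Z and g h :: "'u \<times> 'u \<Rightarrow> 'q"
  proof (rule qmap_ext[OF g h])
    fix v z assume v: "v \<in> plus_pt inl star X" and z: "z \<in> Z"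
    from v consider "v = star" | x where "x \<in> X" "v = inl x" by (auto simp: plus_pt_def)
    then show "g (v, z) = h (v, z)"
    proof cases
      case 1
      with fun_cong[OF eq(2), of "(star, z)"] z show ?thesis by (simp add: qcomp_pt_incl[OF inl])
    next
      case 2
      with fun_cong[OF eq(1), of "(x, z)"] z show ?thesis by (simp add: qcomp_pid[OF inl])
    qed
  qed
  have U_mor: "on_mor (U_T inl star) X Y f = qcopair inl star X (plus_pt inl star Y) f (pt_incl inl star Y)"
    for X Y and f :: "'u \<times> 'u \<Rightarrow> 'q"
    by (auto simp: U_T_def qcopair_def pt_incl_def kron_def fun_eq_iff)
  have U_obj: "on_obj (U_T inl star) X = plus_pt inl star X" for X
    by (simp add: U_T_def)
  have plus: "plus_pt inl star X \<in> \<U>" if "X \<in> \<U>" for X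
    using plus_in[OF that] by (simp add: plus_pt_def)
  have star: "{star} \<in> \<U>" using plus_in[OF empty_in] by simp
  show ?thesis
  proof
    fix X and p :: "'u \<times> 'u \<Rightarrow> 'q"
    assume "X \<in> Obj (QMap \<U> :: ('u set, 'u \<times> 'u \<Rightarrow> 'q) cat)" and "p \<in> Hom (QMap \<U>) {star} X"
    then have X: "X \<in> \<U>" and p: "p \<in> qmap {star} X" by (simp_all add: QMap_def)
    obtain Y \<tau> \<sigma> where Y: "Y \<subseteq> X" and \<tau>: "\<tau> \<in> qmap (plus_pt inl star Y) X" and \<sigma>: "\<sigma> \<in> qmap X (plus_pt inl star Y)"
      "qcomp (plus_pt inl star Y) X (plus_pt inl star Y) \<sigma> \<tau> = qid (plus_pt inl star Y)"
      "qcomp X (plus_pt inl star Y) X \<tau> \<sigma> = qid X" and "\<forall>x\<in>X. \<tau> (star, x) = p (star, x)"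
      using point_complement[OF inl nontrivial p] by blast
    then have "qcomp {star} (plus_pt inl star Y) X \<tau> (pt_incl inl star Y) = p"
      using p by (intro qmap_ext[OF qmap_comp[OF pt_incl_qmap[OF inl]]]) (auto simp: qcomp_pt_incl[OF inl])
    then show "\<exists>Y\<in>Obj (QMap \<U> :: ('u set, 'u \<times> 'u \<Rightarrow> 'q) cat). \<exists>f. is_iso (QMap \<U>) (plus_pt inl star Y) X f \<and>
        Compose (QMap \<U>) {star} (plus_pt inl star Y) X f (pt_incl inl star Y) = p"
      using subset_in[OF X Y] \<tau> \<sigma> by (auto simp: QMap_def is_iso_def)
  qed (auto simp: QMap_def PQMap_def star plus pid_qmap[OF inl] pt_incl_qmap[OF inl] qcopair_qmap[OF inl]
      copair_incl copair_pt U_mor U_obj pcomp_eq_extension[OF inl] intro: plus_ext)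
qed

theorem theorem4p8:
  fixes \<U> :: "'u set set" and inl :: "'u \<Rightarrow> 'u" and star :: 'u
  assumes universe: "set_universe \<U> inl star"
    and nontrivial: "(bot :: 'q::comm_quantale) < 1"
  shows "equivalent_categories
      (PQMap \<U> inl star :: ('u set, 'u \<times> 'u \<Rightarrow> 'q) cat)
      (coslice (QMap \<U> :: ('u set, 'u \<times> 'u \<Rightarrow> 'q) cat) {star})
    \<and> monadic
      (QMap \<U> :: ('u set, 'u \<times> 'u \<Rightarrow> 'q) cat)
      (PQMap \<U> inl star :: ('u set, 'u \<times> 'u \<Rightarrow> 'q) cat)
      (U_T inl star)"
proof -
  interpret maybe_coproduct_complements "QMap \<U> :: ('u set, 'u \<times> 'u \<Rightarrow> 'q) cat" "{star}"
    "plus_pt inl star" "pid inl star" "pt_incl inl star" "qcopair inl star"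
    "PQMap \<U> inl star" "U_T inl star"
    by (rule maybe_coproduct_QMap[OF universe nontrivial])
  show ?thesis
    using equivalence_coslice monadic_U unfolding equivalent_categories_def by blast
qed

end
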